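(* Let $G$ be a group and $\mathbf{A}=(A,\mu,\alpha)$ a dynamical system. If $\mathbf{A}$ is disjoint from every identity system $\mathbf{B}=(B,\nu,\beta)$ (over the same group $G$), then $\mathbf{A}$ is ergodic.
   Context: A dynamical system $\mathbf{A}=(A,\mu,\alpha)$ consists of a $\sigma$-finite von Neumann algebra $A$, a faithful normal state $\mu$ on $A$, and a representation $\alpha:G\to\mathrm{Aut}(A)$ of $G$ as $\ast$-automorphisms of $A$ with $\mu\circ\alpha_g=\mu$ for all $g$. It is an identity system if $\alpha_g=\mathrm{id}_A$ for all $g$. $A\odot B$ denotes the algebraic tensor product. A joining of $\mathbf{A}$ and $\mathbf{B}=(B,\nu,\beta)$ is a state $\omega$ on $A\odot B$ with $\omega(a\otimes 1_B)=\mu(a)$, $\omega(1_A\otimes b)=\nu(b)$ and $\omega\circ(\alpha_g\otimes\beta_g)=\omega$ for all $a,b,g$; $\mathbf{A}$ is disjoint from $\mathbf{B}$ if the only joining is the product state $\mu\otimes\nu$. $\mathbf{A}$ is ergodic if its fixed point algebra $\{a\in A:\alpha_g(a)=a\ \forall g\in G\}$ equals $\mathbb{C}1_A$. *)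

theory Defs
  imports "HOL-Analysis.Analysis" "HOL-Algebra.Group"
begin

class chilbert = ab_group_add +
  fixes cscale :: "complex \<Rightarrow> 'a \<Rightarrow> 'a"
    and cinner :: "'a \<Rightarrow> 'a \<Rightarrow> complex"
  assumes cscale_add_right: "cscale c (x + y) = cscale c x + cscale c y"
    and cscale_add_left: "cscale (c + d) x = cscale c x + cscale d x"
    and cscale_cscale: "cscale c (cscale d x) = cscale (c * d) x"
    and cscale_one: "cscale 1 x = x"
    and cinner_cnj: "cinner x y = cnj (cinner y x)"
    and cinner_add_right: "cinner x (y + z) = cinner x y + cinner x z"
    and cinner_scale_right: "cinner x (cscale c y) = c * cinner x y"
    and cinner_nonneg: "0 \<le> Re (cinner x x)"
    and cinner_eq_zero: "cinner x x = 0 \<longleftrightarrow> x = 0"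
    and chilbert_complete:
      "(\<forall>e>0. \<exists>N. \<forall>m\<ge>N. \<forall>n\<ge>N. sqrt (Re (cinner (X m - X n) (X m - X n))) < e)
        \<Longrightarrow> \<exists>l. (\<lambda>n. sqrt (Re (cinner (X n - l) (X n - l)))) \<longlonglongrightarrow> 0"

definition hnorm :: "'h::chilbert \<Rightarrow> real" where
  "hnorm x = sqrt (Re (cinner x x))"

definition bop :: "('h::chilbert \<Rightarrow> 'h) \<Rightarrow> bool" where
  "bop T \<longleftrightarrow> (\<forall>x y. T (x + y) = T x + T y) \<and> (\<forall>c x. T (cscale c x) = cscale c (T x))
      \<and> (\<exists>K. \<forall>x. hnorm (T x) \<le> K * hnorm x)"

definition adj :: "('h::chilbert \<Rightarrow> 'h) \<Rightarrow> ('h \<Rightarrow> 'h)" where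
  "adj T = (THE S. bop S \<and> (\<forall>x y. cinner (T x) y = cinner x (S y)))"

definition op_add :: "('h::chilbert \<Rightarrow> 'h) \<Rightarrow> ('h \<Rightarrow> 'h) \<Rightarrow> ('h \<Rightarrow> 'h)" where
  "op_add T S = (\<lambda>x. T x + S x)"

definition op_scale :: "complex \<Rightarrow> ('h::chilbert \<Rightarrow> 'h) \<Rightarrow> ('h \<Rightarrow> 'h)" where
  "op_scale c T = (\<lambda>x. cscale c (T x))"

definition op_zero :: "'h::chilbert \<Rightarrow> 'h" where
  "op_zero = (\<lambda>x. 0)"

definition cpos :: "complex \<Rightarrow> bool" where
  "cpos z \<longleftrightarrow> Im z = 0 \<and> 0 \<le> Re z"

definition op_le :: "('h::chilbert \<Rightarrow> 'h) \<Rightarrow> ('h \<Rightarrow> 'h) \<Rightarrow> bool" where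
  "op_le T S \<longleftrightarrow> (\<forall>x. cpos (cinner x (S x) - cinner x (T x)))"

definition selfadj :: "('h::chilbert \<Rightarrow> 'h) \<Rightarrow> bool" where
  "selfadj T \<longleftrightarrow> bop T \<and> adj T = T"

definition is_projection :: "('h::chilbert \<Rightarrow> 'h) \<Rightarrow> bool" where
  "is_projection P \<longleftrightarrow> selfadj P \<and> P \<circ> P = P"

definition commutant :: "('h::chilbert \<Rightarrow> 'h) set \<Rightarrow> ('h \<Rightarrow> 'h) set" where
  "commutant S = {T. bop T \<and> (\<forall>U\<in>S. T \<circ> U = U \<circ> T)}"

definition von_neumann_algebra :: "('h::chilbert \<Rightarrow> 'h) set \<Rightarrow> bool" where
  "von_neumann_algebra A \<longleftrightarrow> A \<subseteq> {T. bop T} \<and> (\<forall>T\<in>A. adj T \<in> A)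
      \<and> commutant (commutant A) = A"

definition sigma_finite_vna :: "('h::chilbert \<Rightarrow> 'h) set \<Rightarrow> bool" where
  "sigma_finite_vna A \<longleftrightarrow>
     (\<forall>F. F \<subseteq> A \<and> (\<forall>P\<in>F. is_projection P \<and> P \<noteq> op_zero)
          \<and> (\<forall>P\<in>F. \<forall>Q\<in>F. P \<noteq> Q \<longrightarrow> P \<circ> Q = op_zero) \<longrightarrow> countable F)"

definition is_state :: "('h::chilbert \<Rightarrow> 'h) set \<Rightarrow> (('h \<Rightarrow> 'h) \<Rightarrow> complex) \<Rightarrow> bool" where
  "is_state A \<phi> \<longleftrightarrow>
     (\<forall>T\<in>A. \<forall>S\<in>A. \<phi> (op_add T S) = \<phi> T + \<phi> S)
   \<and> (\<forall>T\<in>A. \<forall>c. \<phi> (op_scale c T) = c * \<phi> T)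
   \<and> (\<forall>T\<in>A. cpos (\<phi> (adj T \<circ> T)))
   \<and> \<phi> id = 1"

definition faithful_state :: "('h::chilbert \<Rightarrow> 'h) set \<Rightarrow> (('h \<Rightarrow> 'h) \<Rightarrow> complex) \<Rightarrow> bool" where
  "faithful_state A \<phi> \<longleftrightarrow> (\<forall>T\<in>A. \<phi> (adj T \<circ> T) = 0 \<longrightarrow> T = op_zero)"

definition normal_state :: "('h::chilbert \<Rightarrow> 'h) set \<Rightarrow> (('h \<Rightarrow> 'h) \<Rightarrow> complex) \<Rightarrow> bool" where
  "normal_state A \<phi> \<longleftrightarrow>
     (\<forall>D S. D \<subseteq> A \<and> D \<noteq> {} \<and> (\<forall>T\<in>D. selfadj T \<and> op_le op_zero T)
        \<and> (\<forall>T\<in>D. \<forall>U\<in>D. \<exists>V\<in>D. op_le T V \<and> op_le U V)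
        \<and> S \<in> A \<and> selfadj S \<and> (\<forall>T\<in>D. op_le T S)
        \<and> (\<forall>U. selfadj U \<and> (\<forall>T\<in>D. op_le T U) \<longrightarrow> op_le S U)
        \<longrightarrow> Re (\<phi> S) = (SUP T\<in>D. Re (\<phi> T)))"

definition star_automorphism ::
  "('h::chilbert \<Rightarrow> 'h) set \<Rightarrow> (('h \<Rightarrow> 'h) \<Rightarrow> ('h \<Rightarrow> 'h)) \<Rightarrow> bool" where
  "star_automorphism A f \<longleftrightarrow> bij_betw f A A
     \<and> (\<forall>T\<in>A. \<forall>S\<in>A. f (op_add T S) = op_add (f T) (f S))
     \<and> (\<forall>T\<in>A. \<forall>c. f (op_scale c T) = op_scale c (f T))
     \<and> (\<forall>T\<in>A. \<forall>S\<in>A. f (T \<circ> S) = f T \<circ> f S)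
     \<and> (\<forall>T\<in>A. f (adj T) = adj (f T))"

definition dynamical_system ::
  "('g, 'm) monoid_scheme \<Rightarrow> ('h::chilbert \<Rightarrow> 'h) set \<Rightarrow> (('h \<Rightarrow> 'h) \<Rightarrow> complex)
     \<Rightarrow> ('g \<Rightarrow> ('h \<Rightarrow> 'h) \<Rightarrow> ('h \<Rightarrow> 'h)) \<Rightarrow> bool" where
  "dynamical_system G A \<mu> \<alpha> \<longleftrightarrow>
     von_neumann_algebra A \<and> sigma_finite_vna A
   \<and> is_state A \<mu> \<and> faithful_state A \<mu> \<and> normal_state A \<mu>
   \<and> (\<forall>g\<in>carrier G. star_automorphism A (\<alpha> g))
   \<and> (\<forall>g\<in>carrier G. \<forall>h\<in>carrier G. \<forall>T\<in>A. \<alpha> (g \<otimes>\<^bsub>G\<^esub> h) T = \<alpha> g (\<alpha> h T))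
   \<and> (\<forall>T\<in>A. \<alpha> \<one>\<^bsub>G\<^esub> T = T)
   \<and> (\<forall>g\<in>carrier G. \<forall>T\<in>A. \<mu> (\<alpha> g T) = \<mu> T)"

definition identity_system ::
  "('g, 'm) monoid_scheme \<Rightarrow> ('h::chilbert \<Rightarrow> 'h) set \<Rightarrow> (('h \<Rightarrow> 'h) \<Rightarrow> complex)
     \<Rightarrow> ('g \<Rightarrow> ('h \<Rightarrow> 'h) \<Rightarrow> ('h \<Rightarrow> 'h)) \<Rightarrow> bool" where
  "identity_system G B \<nu> \<beta> \<longleftrightarrow> dynamical_system G B \<nu> \<beta>
     \<and> (\<forall>g\<in>carrier G. \<forall>T\<in>B. \<beta> g T = T)"

text \<open>A linear functional on the algebraic tensor product A \<odot> B is represented by the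
  bilinear map omega(a, b) = omega(a \<otimes> b) on A \<times> B. Positivity on A \<odot> B:
  omega(x* x) \<ge> 0 for every x = sum_i a_i \<otimes> b_i.\<close>
definition tensor_state ::
  "('h::chilbert \<Rightarrow> 'h) set \<Rightarrow> ('h \<Rightarrow> 'h) set \<Rightarrow> (('h \<Rightarrow> 'h) \<Rightarrow> ('h \<Rightarrow> 'h) \<Rightarrow> complex) \<Rightarrow> bool" where
  "tensor_state A B \<omega> \<longleftrightarrow>
     (\<forall>a\<in>A. \<forall>a'\<in>A. \<forall>b\<in>B. \<omega> (op_add a a') b = \<omega> a b + \<omega> a' b)
   \<and> (\<forall>a\<in>A. \<forall>b\<in>B. \<forall>b'\<in>B. \<omega> a (op_add b b') = \<omega> a b + \<omega> a b')
   \<and> (\<forall>a\<in>A. \<forall>b\<in>B. \<forall>c. \<omega> (op_scale c a) b = c * \<omega> a b \<and> \<omega> a (op_scale c b) = c * \<omega> a b)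
   \<and> (\<forall>n (a::nat \<Rightarrow> 'h \<Rightarrow> 'h) (b::nat \<Rightarrow> 'h \<Rightarrow> 'h). (\<forall>i<n. a i \<in> A \<and> b i \<in> B) \<longrightarrow>
        cpos (\<Sum>i<n. \<Sum>j<n. \<omega> (adj (a i) \<circ> a j) (adj (b i) \<circ> b j)))
   \<and> \<omega> id id = 1"

definition joining ::
  "('g, 'm) monoid_scheme
   \<Rightarrow> ('h::chilbert \<Rightarrow> 'h) set \<Rightarrow> (('h \<Rightarrow> 'h) \<Rightarrow> complex) \<Rightarrow> ('g \<Rightarrow> ('h \<Rightarrow> 'h) \<Rightarrow> ('h \<Rightarrow> 'h))
   \<Rightarrow> ('h \<Rightarrow> 'h) set \<Rightarrow> (('h \<Rightarrow> 'h) \<Rightarrow> complex) \<Rightarrow> ('g \<Rightarrow> ('h \<Rightarrow> 'h) \<Rightarrow> ('h \<Rightarrow> 'h))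
   \<Rightarrow> (('h \<Rightarrow> 'h) \<Rightarrow> ('h \<Rightarrow> 'h) \<Rightarrow> complex) \<Rightarrow> bool" where
  "joining G A \<mu> \<alpha> B \<nu> \<beta> \<omega> \<longleftrightarrow> tensor_state A B \<omega>
     \<and> (\<forall>a\<in>A. \<omega> a id = \<mu> a) \<and> (\<forall>b\<in>B. \<omega> id b = \<nu> b)
     \<and> (\<forall>g\<in>carrier G. \<forall>a\<in>A. \<forall>b\<in>B. \<omega> (\<alpha> g a) (\<beta> g b) = \<omega> a b)"

definition disjoint_systems ::
  "('g, 'm) monoid_scheme
   \<Rightarrow> ('h::chilbert \<Rightarrow> 'h) set \<Rightarrow> (('h \<Rightarrow> 'h) \<Rightarrow> complex) \<Rightarrow> ('g \<Rightarrow> ('h \<Rightarrow> 'h) \<Rightarrow> ('h \<Rightarrow> 'h))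
   \<Rightarrow> ('h \<Rightarrow> 'h) set \<Rightarrow> (('h \<Rightarrow> 'h) \<Rightarrow> complex) \<Rightarrow> ('g \<Rightarrow> ('h \<Rightarrow> 'h) \<Rightarrow> ('h \<Rightarrow> 'h)) \<Rightarrow> bool" where
  "disjoint_systems G A \<mu> \<alpha> B \<nu> \<beta> \<longleftrightarrow>
     (\<forall>\<omega>. joining G A \<mu> \<alpha> B \<nu> \<beta> \<omega> \<longrightarrow> (\<forall>a\<in>A. \<forall>b\<in>B. \<omega> a b = \<mu> a * \<nu> b))"

definition fixed_point_algebra ::
  "('g, 'm) monoid_scheme \<Rightarrow> ('h::chilbert \<Rightarrow> 'h) set \<Rightarrow> ('g \<Rightarrow> ('h \<Rightarrow> 'h) \<Rightarrow> ('h \<Rightarrow> 'h))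
     \<Rightarrow> ('h \<Rightarrow> 'h) set" where
  "fixed_point_algebra G A \<alpha> = {a\<in>A. \<forall>g\<in>carrier G. \<alpha> g a = a}"

definition ergodic ::
  "('g, 'm) monoid_scheme \<Rightarrow> ('h::chilbert \<Rightarrow> 'h) set \<Rightarrow> ('g \<Rightarrow> ('h \<Rightarrow> 'h) \<Rightarrow> ('h \<Rightarrow> 'h)) \<Rightarrow> bool" where
  "ergodic G A \<alpha> \<longleftrightarrow> fixed_point_algebra G A \<alpha> = {op_scale c id | c. True}"

end

theory Submission
  imports Defs
begin

text \<open>
  If the fixed point algebra is not trivial, it contains a self-adjoint \<open>a\<close> with \<open>\<mu> a = 0\<close> and
  \<open>a \<le> 0\<close> false. It suffices to find an invariant positive functional \<open>\<psi> \<le> \<mu>\<close> with \<open>\<psi> a > 0\<close>: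
  splitting \<open>\<mu> = \<mu>\<^sub>1 + \<mu>\<^sub>2\<close> with \<open>\<mu>\<^sub>1 = (\<mu> + \<psi>) / 3\<close> then defines a joining of the system with an
  identity system on the two-dimensional algebra spanned by a rank one projection \<open>p\<close> and \<open>1 - p\<close>,
  namely \<open>a \<otimes> (c p + d (1 - p)) \<mapsto> c \<mu>\<^sub>1 a + d \<mu>\<^sub>2 a\<close>, and it is not the product state.

  To find \<open>\<psi>\<close>, minimise \<open>\<mu>(d\<^sup>2) + 2 \<mu>(c)\<close> over self-adjoint \<open>d\<close> and positive \<open>c\<close> with \<open>c + d \<ge> a\<close>.
  This combines the Hahn--Banach theorem with the selection of a point of minimal norm, so the
  optimum is unique, hence invariant, and its derivative \<open>\<psi> x = Re \<mu>(d x)\<close> is the functional.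
  The optimal value is positive because of normality and faithfulness: were it 0, there would be
  \<open>e\<^sub>n \<ge> 0\<close>, \<open>e\<^sub>n \<ge> a\<close>, with \<open>\<mu>(e\<^sub>n) \<le> C / 2\<^sup>n\<close>, and the resolvents of the sums of the \<open>e\<^sub>n\<close> force \<open>a \<le> 0\<close>.
\<close>

text \<open>For a fixed \<open>a\<close>, the obvious candidate
  \<open>x \<mapsto> \<mu>(a x)\<close> need be neither positive nor hermitian, because \<mu> is not
  assumed tracial; hence the detour through optimisation. With the price \<open>2 \<mu>(c)\<close>
  alone one would get the linear dual of maximising \<open>\<psi>(a)\<close> over
  \<open>0 \<le> \<psi> \<le> \<mu>\<close>. Its optima need not be unique, and an arbitrary group
  offers no averaging to make one of them invariant. The quadratic term is strictly convex in the
  \<open>L2(\<mu>)\<close> norm and so selects one functional. The optimal \<open>d\<close> lives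
  only in the \<open>L2(\<mu>)\<close> completion, not in \<open>A\<close>, so every argument runs
  along a minimising sequence. Positivity in the constraints means being a sum of squares, which
  every *-automorphism visibly preserves. The operator order is handled by quadratic forms and
  resolvents instead of functional calculus. Disjointness here ranges over algebras on the same
  Hilbert space type \<open>'h\<close> as \<open>A\<close>. The two-dimensional algebra is therefore
  built from two orthonormal vectors of \<open>'h\<close>, which exist as soon as some operator is
  not scalar.\<close>

lemma quadratic_nonneg_discriminant:
  fixes a b c :: real
  assumes "\<And>t. 0 \<le> a + 2 * t * b + t^2 * c" and "0 \<le> c"
  shows "b^2 \<le> a * c"
proof (cases "c = 0")
  case True
  have "b = 0"
  proof (rule ccontr)
    assume "b \<noteq> 0"
    with assms(1)[of "- (a + 1) / (2 * b)"] True show False by (simp add: field_simps)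
  qed
  with True show ?thesis by simp
next
  case False
  with assms(2) have "c > 0" by simp
  with assms(1)[of "- b / c"] show ?thesis
    by (simp add: field_simps power2_eq_square)
qed

text \<open>Extracts the first-order condition from a one-sided perturbation of an optimum: after
  division by \<open>t\<close>, small \<open>t\<close> removes the quadratic term. The bound
  \<open>t \<le> 1\<close> allows perturbations that are convex combinations.\<close>

lemma linear_coefficient_nonneg:
  fixes a c :: real
  assumes "\<And>t. 0 < t \<Longrightarrow> t \<le> 1 \<Longrightarrow> 0 \<le> t * a + t^2 * c"
  shows "0 \<le> a"
proof (rule ccontr)
  assume "\<not> 0 \<le> a"
  then have a: "a < 0" by simp
  \<comment> \<open>Small enough that \<open>t * c \<le> - a / 2\<close>; the \<open>+ 1\<close>
    keeps the denominator positive.\<close>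
  define t where "t = min 1 (- a / (2 * (\<bar>c\<bar> + 1)))"
  have t: "0 < t" "t \<le> 1" using a by (auto simp: t_def divide_simps)
  have "t * c \<le> t * (\<bar>c\<bar> + 1)" using t by (intro mult_left_mono) auto
  also have "\<dots> \<le> - a / (2 * (\<bar>c\<bar> + 1)) * (\<bar>c\<bar> + 1)"
    by (intro mult_right_mono) (auto simp: t_def)
  also have "\<dots> = - a / 2" by (simp add: field_simps add_nonneg_eq_0_iff)
  finally have "t * (a + t * c) < 0" using a t by (intro mult_pos_neg) auto
  with assms[OF t] show False by (simp add: algebra_simps power2_eq_square)
qed

section \<open>Hilbert spaces\<close>

lemma cinner_add_left: "cinner (x + y) (z::'h::chilbert) = cinner x z + cinner y z"
  by (metis cinner_cnj cinner_add_right complex_cnj_add)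

lemma cinner_scale_left: "cinner (cscale c x) (y::'h::chilbert) = cnj c * cinner x y"
  by (metis cinner_cnj cinner_scale_right complex_cnj_mult)

lemma cinner_zero_right [simp]: "cinner x (0::'h::chilbert) = 0"
  using cinner_add_right[of x 0 0] by simp

lemma cinner_zero_left [simp]: "cinner (0::'h::chilbert) x = 0"
  using cinner_add_left[of 0 0 x] by simp

lemma cinner_minus_right: "cinner x (- y::'h::chilbert) = - cinner x y"
  using cinner_add_right[of x y "- y"] by (simp add: add_eq_0_iff)

lemma cinner_minus_left: "cinner (- x::'h::chilbert) y = - cinner x y"
  using cinner_add_left[of x "- x" y] by (simp add: add_eq_0_iff)

lemma cinner_diff_right: "cinner x (y - z::'h::chilbert) = cinner x y - cinner x z"
  using cinner_add_right[of x y "- z"] by (simp add: cinner_minus_right)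

lemma cinner_diff_left: "cinner (x - y::'h::chilbert) z = cinner x z - cinner y z"
  using cinner_add_left[of x "- y" z] by (simp add: cinner_minus_left)

lemmas cinner_simps = cinner_add_left cinner_add_right cinner_diff_left cinner_diff_right
  cinner_minus_left cinner_minus_right cinner_scale_left cinner_scale_right

lemma cscale_zero_right [simp]: "cscale c (0::'h::chilbert) = 0"
  using cscale_add_right[of c 0 "0::'h"] by simp

lemma cscale_minus_right: "cscale c (- x::'h::chilbert) = - cscale c x"
  using cscale_add_right[of c x "- x"] by (simp add: add_eq_0_iff)

lemma cscale_diff_right: "cscale c (x - y::'h::chilbert) = cscale c x - cscale c y"
  using cscale_add_right[of c x "- y"] by (simp add: cscale_minus_right)

lemma cscale_zero_left [simp]: "cscale 0 (x::'h::chilbert) = 0"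
  using cscale_add_left[of 0 0 x] by simp

lemma cscale_minus_left: "cscale (- c) (x::'h::chilbert) = - cscale c x"
  using cscale_add_left[of c "- c" x] by (simp add: add_eq_0_iff)

lemma cinner_ext_right:
  assumes "\<And>z. cinner z x = cinner z (y::'h::chilbert)"
  shows "x = y"
proof -
  have "cinner (x - y) (x - y) = 0" using assms by (simp add: cinner_diff_right)
  then show ?thesis by (simp add: cinner_eq_zero)
qed

lemma cinner_ext_left:
  assumes "\<And>z. cinner x z = cinner (y::'h::chilbert) z"
  shows "x = y"
proof -
  have "cinner (x - y) (x - y) = 0" using assms by (simp add: cinner_diff_left)
  then show ?thesis by (simp add: cinner_eq_zero)
qed

lemma Re_cinner_commute: "Re (cinner y (x::'h::chilbert)) = Re (cinner x y)"
  using cinner_cnj[of y x] by simp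

lemma hnorm_sq: "(hnorm (x::'h::chilbert))^2 = Re (cinner x x)"
  by (simp add: hnorm_def cinner_nonneg)

lemma hnorm_nonneg [simp]: "0 \<le> hnorm (x::'h::chilbert)"
  by (simp add: hnorm_def cinner_nonneg)

lemma Im_cinner_self [simp]: "Im (cinner (x::'h::chilbert) x) = 0"
  using cinner_cnj[of x x] by (simp add: complex_eq_iff)

lemma cinner_self: "cinner (x::'h::chilbert) x = complex_of_real ((hnorm x)^2)"
  by (simp add: hnorm_sq complex_eq_iff)

lemma hnorm_zero [simp]: "hnorm (0::'h::chilbert) = 0"
  by (simp add: hnorm_def)

lemma hnorm_eq_zero: "hnorm (x::'h::chilbert) = 0 \<longleftrightarrow> x = 0"
  by (metis cinner_self cinner_eq_zero hnorm_zero of_real_0 zero_power2)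

lemma Re_cinner_le: "\<bar>Re (cinner x (y::'h::chilbert))\<bar> \<le> hnorm x * hnorm y"
proof -
  have "0 \<le> (hnorm x)^2 + 2 * t * Re (cinner x y) + t^2 * (hnorm y)^2" for t
    using cinner_nonneg[of "x + cscale (of_real t) y"] unfolding hnorm_sq
    by (simp add: cinner_simps Re_cinner_commute[of y x] algebra_simps power2_eq_square)
  then have "(Re (cinner x y))^2 \<le> (hnorm x)^2 * (hnorm y)^2"
    by (rule quadratic_nonneg_discriminant) simp
  then have "\<bar>Re (cinner x y)\<bar>^2 \<le> (hnorm x * hnorm y)^2"
    by (simp add: power_mult_distrib)
  then show ?thesis by (rule power2_le_imp_le) simp
qed

lemma hnorm_triangle: "hnorm (x + y::'h::chilbert) \<le> hnorm x + hnorm y"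
proof (rule power2_le_imp_le)
  have "(hnorm (x + y))^2 = (hnorm x)^2 + (hnorm y)^2 + 2 * Re (cinner x y)"
    by (simp add: hnorm_sq cinner_simps Re_cinner_commute[of y x])
  with Re_cinner_le[of x y] show "(hnorm (x + y))^2 \<le> (hnorm x + hnorm y)^2"
    by (simp add: power2_eq_square algebra_simps)
qed simp

lemma hnorm_cscale: "hnorm (cscale c (x::'h::chilbert)) = cmod c * hnorm x"
proof -
  have "(hnorm (cscale c x))^2 = (cmod c * hnorm x)^2"
    unfolding power_mult_distrib hnorm_sq cmod_power2
    by (simp add: cinner_simps power2_eq_square algebra_simps)
  then show ?thesis by simp
qed

lemma hnorm_minus: "hnorm (- x::'h::chilbert) = hnorm x"
  by (simp add: hnorm_def cinner_simps)

text \<open>The factor 2 comes from bounding real and imaginary part separately; for continuity any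
  constant will do.\<close>

lemma cmod_cinner_le: "cmod (cinner x (y::'h::chilbert)) \<le> 2 * (hnorm x * hnorm y)"
proof -
  have "Im (cinner x y) = - Re (cinner x (cscale \<i> y))" by (simp add: cinner_simps)
  then have "\<bar>Im (cinner x y)\<bar> \<le> hnorm x * hnorm y"
    using Re_cinner_le[of x "cscale \<i> y"] by (simp add: hnorm_cscale)
  with Re_cinner_le[of x y] cmod_le[of "cinner x y"] show ?thesis by linarith
qed

text \<open>The class \<open>chilbert\<close> carries no topology, so norm convergence is expressed
  through a real sequence.\<close>

definition hlim :: "(nat \<Rightarrow> 'h::chilbert) \<Rightarrow> 'h \<Rightarrow> bool" where
  "hlim X l \<longleftrightarrow> (\<lambda>n. hnorm (X n - l)) \<longlonglongrightarrow> 0"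

lemma hlim_cinner_right:
  assumes "hlim X l" shows "(\<lambda>n. cinner y (X n)) \<longlonglongrightarrow> cinner y l"
proof -
  have "(\<lambda>n. 2 * (hnorm y * hnorm (X n - l))) \<longlonglongrightarrow> 0"
    using tendsto_mult_left[OF assms[unfolded hlim_def], of "2 * hnorm y"] by (simp add: mult.assoc)
  then have "(\<lambda>n. cinner y (X n) - cinner y l) \<longlonglongrightarrow> 0"
    by (rule Lim_null_comparison[rotated])
      (auto intro!: always_eventually simp: cinner_diff_right[symmetric] cmod_cinner_le)
  then show ?thesis by (rule LIM_zero_cancel)
qed

lemma hlim_cinner_left:
  assumes "hlim X l" shows "(\<lambda>n. cinner (X n) y) \<longlonglongrightarrow> cinner l y"
proof -
  have "(\<lambda>n. cnj (cinner y (X n))) \<longlonglongrightarrow> cnj (cinner y l)"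
    by (intro tendsto_cnj hlim_cinner_right assms)
  moreover have "cnj (cinner y (X n)) = cinner (X n) y" for n by (rule cinner_cnj[symmetric])
  moreover have "cnj (cinner y l) = cinner l y" by (rule cinner_cnj[symmetric])
  ultimately show ?thesis by (simp only:)
qed

text \<open>Completeness in the shape that positivity arguments deliver: a bound on the squared
  distance, depending on the smaller index.\<close>

lemma hlim_exists:
  assumes "\<And>m n. n \<le> m \<Longrightarrow> (hnorm (X m - X n :: 'h::chilbert))^2 \<le> b n" and "b \<longlonglongrightarrow> 0"
  shows "\<exists>l. hlim X l"
  unfolding hlim_def hnorm_def
proof (rule chilbert_complete, intro allI impI)
  fix e :: real assume "e > 0"
  then have "\<forall>\<^sub>F n in sequentially. b n < e^2" using assms(2) by (intro order_tendstoD(2)[of b 0]) auto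
  then obtain N where N: "b n < e^2" if "n \<ge> N" for n by (auto simp: eventually_sequentially)
  show "\<exists>N. \<forall>m\<ge>N. \<forall>n\<ge>N. sqrt (Re (cinner (X m - X n) (X m - X n))) < e"
  proof (intro exI allI impI)
    fix m n assume mn: "m \<ge> N" "n \<ge> N"
    have "(hnorm (X m - X n))^2 < e^2"
    proof (cases "n \<le> m")
      case True with assms(1) N mn show ?thesis by (meson order_le_less_trans)
    next
      case False
      then have "(hnorm (X n - X m))^2 < e^2" using assms(1) N mn by (meson nat_le_linear order_le_less_trans)
      then show ?thesis using hnorm_minus[of "X n - X m"] by simp
    qed
    then have "hnorm (X m - X n) < e" using \<open>e > 0\<close> by (simp add: power2_less_imp_less)
    then show "sqrt (Re (cinner (X m - X n) (X m - X n))) < e" by (simp add: hnorm_def)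
  qed
qed

section \<open>Bounded operators and adjoints\<close>

lemma bop_add: "bop T \<Longrightarrow> T (x + y) = T x + T y"
  by (simp add: bop_def)

lemma bop_scale: "bop T \<Longrightarrow> T (cscale c x) = cscale c (T x)"
  by (simp add: bop_def)

lemma bop_bound:
  assumes "bop T" shows "\<exists>K\<ge>0. \<forall>x. hnorm (T x) \<le> K * hnorm x"
proof -
  from assms obtain K where K: "\<And>x. hnorm (T x) \<le> K * hnorm x" by (auto simp: bop_def)
  have "hnorm (T x) \<le> \<bar>K\<bar> * hnorm x" for x
    using K[of x] mult_right_mono[OF abs_ge_self hnorm_nonneg, of K x] by linarith
  then show ?thesis by (intro exI[of _ "\<bar>K\<bar>"]) simp
qed

lemma bop_zero: "bop T \<Longrightarrow> T 0 = 0"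
  using bop_add[of T 0 0] by simp

lemma bop_minus: "bop T \<Longrightarrow> T (- x) = - T x"
  using bop_add[of T x "- x"] by (simp add: bop_zero add_eq_0_iff)

lemma bop_diff: "bop T \<Longrightarrow> T (x - y) = T x - T y"
  using bop_add[of T x "- y"] by (simp add: bop_minus)

lemma bopI:
  assumes "\<And>x y. T (x + y) = T x + T y" "\<And>c x. T (cscale c x) = cscale c (T x)"
    "\<And>x. hnorm (T x) \<le> K * hnorm x"
  shows "bop T"
  using assms by (auto simp: bop_def)

lemma bop_op_add: assumes "bop S" "bop T" shows "bop (\<lambda>x. S x + T x)"
proof -
  obtain K L where "\<And>x. hnorm (S x) \<le> K * hnorm x" "\<And>x. hnorm (T x) \<le> L * hnorm x"
    using assms by (auto simp: bop_def)
  then have "hnorm (S x + T x) \<le> (K + L) * hnorm x" for x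
    using hnorm_triangle[of "S x" "T x"] by (smt (verit) distrib_right)
  with assms show ?thesis by (intro bopI) (auto simp: bop_add bop_scale cscale_add_right)
qed

lemma bop_op_scale: assumes "bop T" shows "bop (\<lambda>x. cscale c (T x))"
proof -
  obtain K where "\<And>x. hnorm (T x) \<le> K * hnorm x" using assms by (auto simp: bop_def)
  then have "hnorm (cscale c (T x)) \<le> (cmod c * K) * hnorm x" for x
    by (simp add: hnorm_cscale mult.assoc mult_left_mono)
  then show ?thesis
    by (intro bopI[where K="cmod c * K"])
      (simp_all add: bop_add[OF assms] bop_scale[OF assms] cscale_add_right cscale_cscale mult.commute)
qed

lemma bop_comp: assumes "bop S" "bop T" shows "bop (\<lambda>x. S (T x))"
proof -
  obtain K where K: "0 \<le> K" "\<And>x. hnorm (S x) \<le> K * hnorm x" using bop_bound[OF assms(1)] by auto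
  obtain L where L: "\<And>x. hnorm (T x) \<le> L * hnorm x" using assms by (auto simp: bop_def)
  have "hnorm (S (T x)) \<le> (K * L) * hnorm x" for x
    using order_trans[OF K(2) mult_left_mono[OF L K(1)]] by (simp add: mult.assoc)
  with assms show ?thesis by (intro bopI) (auto simp: bop_add bop_scale)
qed

lemma bop_id: "bop (\<lambda>x. x)" by (rule bopI[where K=1]) auto

lemma bop_const_zero: "bop (\<lambda>x. 0)" by (rule bopI[where K=0]) auto

lemma bop_uminus: assumes "bop T" shows "bop (\<lambda>x. - T x)"
  using bop_op_scale[OF assms, of "-1"] by (simp add: cscale_minus_left cscale_one)

text \<open>Proved by minimising \<open>\<langle>z, W z\<rangle> - 2 Re f z\<close>: the case \<open>W = id\<close> is
  the Riesz representation theorem, the case \<open>f = \<langle>x, \<cdot>\<rangle>\<close> inverts \<open>W\<close>.\<close>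

lemma lax_milgram:
  fixes W :: "'h::chilbert \<Rightarrow> 'h" and f :: "'h \<Rightarrow> complex"
  assumes W: "bop W" "\<And>x y. cinner (W x) y = cinner x (W y)"
    and coercive: "\<And>x. (hnorm x)^2 \<le> Re (cinner x (W x))"
    and f: "\<And>x y. f (x + y) = f x + f y" "\<And>c x. f (cscale c x) = c * f x"
    and K: "\<And>x. Re (f x) \<le> K * hnorm x"
  shows "\<exists>y. \<forall>z. f z = cinner y (W z)"
proof -
  define J where "J z = Re (cinner z (W z)) - 2 * Re (f z)" for z
  have J_ge: "- (K^2) \<le> J z" for z
  proof -
    have "- (K^2) \<le> (hnorm z)^2 - 2 * (K * hnorm z)"
      using zero_le_power2[of "hnorm z - K"] by (simp add: power2_eq_square algebra_simps)
    also have "\<dots> \<le> J z" using coercive[of z] K[of z] by (simp add: J_def)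
    finally show ?thesis .
  qed
  define F where "F = Inf (range J)"
  have bdd: "bdd_below (range J)" using J_ge by (auto intro!: bdd_belowI)
  have F_le: "F \<le> J z" for z unfolding F_def using bdd by (intro cInf_lower) auto
  have "\<exists>z. J z < F + 1 / Suc n" for n
    using cInf_lessD[of "range J" "F + 1 / Suc n"] by (auto simp: F_def)
  then obtain y where y: "\<And>n. J (y n) < F + 1 / Suc n" by metis
  have Wsym: "Re (cinner v (W u)) = Re (cinner u (W v))" for u v
    using W(2)[of u v] Re_cinner_commute[of v "W u"] by simp
  have J_add: "J (u + cscale (of_real t) v)
      = J u + 2 * t * (Re (cinner u (W v)) - Re (f v)) + t^2 * Re (cinner v (W v))" for u v t
    by (simp add: J_def f bop_add[OF W(1)] bop_scale[OF W(1)] cinner_simps Wsym[of v u]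
        algebra_simps power2_eq_square)
  \<comment> \<open>Parallelogram argument: \<open>J\<close> is at least \<open>F\<close> at the
    midpoint \<open>y n + v\<close>, so two nearly optimal points leave little room for
    \<open>v\<close>, half of their difference.\<close>
  have "(hnorm (y m - y n))^2 \<le> 4 * (1 / Suc n)" if "n \<le> m" for m n
  proof -
    define v where "v = cscale (1/2) (y m - y n)"
    have 1: "y m = (y n + v) + cscale (of_real 1) v"
      unfolding v_def using cscale_add_left[of "1/2" "1/2" "y m - y n"]
      by (simp add: cscale_one add.assoc)
    have 2: "y n = (y n + v) + cscale (of_real (-1)) v"
      by (simp add: cscale_one cscale_minus_left)
    have "J (y m) + J (y n) = 2 * J (y n + v) + 2 * Re (cinner v (W v))"
      using J_add[of "y n + v" 1 v] J_add[of "y n + v" "-1" v]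
      unfolding 1[symmetric] 2[symmetric] by simp
    moreover have "1 / Suc m \<le> 1 / real (Suc n)" using that by (simp add: frac_le)
    ultimately have "Re (cinner v (W v)) \<le> 1 / Suc n"
      using F_le[of "y n + v"] y[of m] y[of n] by linarith
    then have "(hnorm v)^2 \<le> 1 / Suc n" using coercive[of v] by linarith
    then show ?thesis by (simp add: v_def hnorm_cscale power_mult_distrib power2_eq_square)
  qed
  moreover have "(\<lambda>n. 4 * (1 / real (Suc n))) \<longlonglongrightarrow> 4 * 0"
    by (intro tendsto_mult tendsto_const LIMSEQ_Suc lim_1_over_n)
  ultimately obtain l where l: "hlim y l" using hlim_exists[of y "\<lambda>n. 4 * (1 / Suc n)"] by auto
  have ge: "0 \<le> Re (cinner l (W z)) - Re (f z)" for z
  proof (rule linear_coefficient_nonneg)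
    fix t :: real assume "0 < t"
    have "0 \<le> 1 / Suc n + 2 * t * (Re (cinner (y n) (W z)) - Re (f z)) + t^2 * Re (cinner z (W z))" for n
      using J_add[of "y n" t z] F_le[of "y n + cscale (of_real t) z"] y[of n] by linarith
    moreover have "(\<lambda>n. 1 / Suc n + 2 * t * (Re (cinner (y n) (W z)) - Re (f z)) + t^2 * Re (cinner z (W z)))
       \<longlonglongrightarrow> 0 + 2 * t * (Re (cinner l (W z)) - Re (f z)) + t^2 * Re (cinner z (W z))"
      by (intro tendsto_intros LIMSEQ_Suc lim_1_over_n hlim_cinner_left[OF l])
    ultimately have "0 \<le> 0 + 2 * t * (Re (cinner l (W z)) - Re (f z)) + t^2 * Re (cinner z (W z))"
      by (intro LIMSEQ_le_const) auto
    then show "0 \<le> t * (Re (cinner l (W z)) - Re (f z)) + t^2 * (Re (cinner z (W z)) / 2)"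
      by (simp add: algebra_simps)
  qed
  have eq: "Re (cinner l (W z)) = Re (f z)" for z
    using ge[of z] ge[of "cscale (-1) z"]
    by (simp add: bop_scale[OF W(1)] cinner_simps f)
  \<comment> \<open>Multiplication by \<open>- \<i>\<close> turns imaginary parts into real parts,
    so the real identity at \<open>cscale (- \<i>) z\<close> supplies the missing half.\<close>
  have "f z = cinner l (W z)" for z
    using eq[of z] eq[of "cscale (-\<i>) z"]
    by (simp add: bop_scale[OF W(1)] cinner_simps f complex_eq_iff)
  then show ?thesis by blast
qed

lemma riesz_representation:
  assumes "\<And>x y. f (x + y) = f x + f y" "\<And>c x. f (cscale c x) = c * f x"
    "\<And>x. Re (f x) \<le> K * hnorm (x::'h::chilbert)"
  shows "\<exists>y. \<forall>z. f z = cinner y z"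
  by (rule lax_milgram[of "\<lambda>x. x" f K]) (simp_all add: assms bop_id hnorm_sq)

lemma adj_exists:
  assumes "bop (T :: 'h::chilbert \<Rightarrow> 'h)"
  shows "\<exists>S. bop S \<and> (\<forall>x y. cinner (T x) y = cinner x (S y))"
proof -
  obtain K where K: "0 \<le> K" "\<And>x. hnorm (T x) \<le> K * hnorm x" using bop_bound[OF assms] by auto
  have "\<exists>s. \<forall>x. cinner y (T x) = cinner s x" for y
  proof (rule riesz_representation)
    fix x show "Re (cinner y (T x)) \<le> (hnorm y * K) * hnorm x"
      using Re_cinner_le[of y "T x"] mult_left_mono[OF K(2)[of x], of "hnorm y"] by (simp add: mult.assoc)
  qed (simp_all add: bop_add[OF assms] bop_scale[OF assms] cinner_simps)
  then have "\<forall>y. \<exists>s. \<forall>x. cinner y (T x) = cinner s x" by blast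
  from choice[OF this] obtain S where S: "\<And>x y. cinner y (T x) = cinner (S y) x" by blast
  have S': "cinner (T x) y = cinner x (S y)" for x y
    using S[of y x] cinner_cnj[of "T x" y] cinner_cnj[of x "S y"] by simp
  have "hnorm (S y) \<le> K * hnorm y" for y
  proof -
    have "(hnorm (S y))^2 = Re (cinner (T (S y)) y)" by (simp add: hnorm_sq S')
    also have "\<dots> \<le> (K * hnorm (S y)) * hnorm y"
      using Re_cinner_le[of "T (S y)" y] mult_right_mono[OF K(2)[of "S y"], of "hnorm y"] by simp
    finally have "hnorm (S y) * hnorm (S y) \<le> hnorm (S y) * (K * hnorm y)"
      by (simp add: power2_eq_square mult_ac)
    then show ?thesis using K(1) by (cases "hnorm (S y) = 0") (auto simp: mult_le_cancel_left_pos less_le)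
  qed
  moreover have "S (y + z) = S y + S z" "S (cscale c y) = cscale c (S y)" for y z c
    by (rule cinner_ext_right; simp add: cinner_simps flip: S')+
  ultimately have "bop S" by (intro bopI[of S K])
  with S' show ?thesis by blast
qed

lemma adj_unique:
  assumes "\<And>x y. cinner (T x) y = cinner x (S y)" "\<And>x y. cinner (T x) y = cinner (x::'h::chilbert) (S' y)"
  shows "S = S'"
proof
  fix y show "S y = S' y" by (rule cinner_ext_right) (simp flip: assms)
qed

text \<open>Existence by Riesz and uniqueness make the \<open>THE\<close> in \<open>adj\<close>
  denote; all later facts about adjoints start here.\<close>

lemma adj_props:
  assumes "bop (T :: 'h::chilbert \<Rightarrow> 'h)"
  shows "bop (adj T)" "cinner (T x) y = cinner x (adj T y)"
proof -
  obtain S where S: "bop S \<and> (\<forall>x y. cinner (T x) y = cinner x (S y))" using adj_exists[OF assms] by blast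
  have "bop (adj T) \<and> (\<forall>x y. cinner (T x) y = cinner x (adj T y))"
    unfolding adj_def by (rule theI[of _ S]) (use S in \<open>auto intro: adj_unique[of T]\<close>)
  then show "bop (adj T)" "cinner (T x) y = cinner x (adj T y)" by auto
qed

section \<open>The algebra of bounded operators\<close>

typedef (overloaded) 'h cop = "{T :: 'h::chilbert \<Rightarrow> 'h. bop T}"
  morphisms ap Cop
  using bop_id by blast

setup_lifting type_definition_cop

lemma bop_ap: "bop (ap t)" using ap by blast

lemma cop_eqI: "(\<And>x. ap s x = ap t x) \<Longrightarrow> s = t"
  by (metis ap_inject ext)

text \<open>The class \<open>real_algebra_1\<close> would demand \<open>0 \<noteq> 1\<close>, which
  fails on the zero space; \<open>monoid_mult\<close> still supplies the unit.\<close>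

instantiation cop :: (chilbert) "{real_algebra, monoid_mult}"
begin

lift_definition zero_cop :: "'a cop" is "\<lambda>x. 0" by (rule bop_const_zero)
lift_definition one_cop :: "'a cop" is "\<lambda>x. x" by (rule bop_id)
lift_definition plus_cop :: "'a cop \<Rightarrow> 'a cop \<Rightarrow> 'a cop" is "\<lambda>S T x. S x + T x" by (rule bop_op_add)
lift_definition uminus_cop :: "'a cop \<Rightarrow> 'a cop" is "\<lambda>T x. - T x" by (rule bop_uminus)
lift_definition minus_cop :: "'a cop \<Rightarrow> 'a cop \<Rightarrow> 'a cop" is "\<lambda>S T x. S x - T x"
  using bop_op_add[OF _ bop_uminus] by fastforce
lift_definition times_cop :: "'a cop \<Rightarrow> 'a cop \<Rightarrow> 'a cop" is "\<lambda>S T x. S (T x)" by (rule bop_comp)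
lift_definition scaleR_cop :: "real \<Rightarrow> 'a cop \<Rightarrow> 'a cop" is "\<lambda>r T x. cscale (of_real r) (T x)"
  by (rule bop_op_scale)

instance
  by standard (transfer; force simp: bop_add bop_scale cscale_add_left cscale_add_right cscale_cscale
      cscale_one algebra_simps)+

end

lift_definition scC :: "complex \<Rightarrow> 'h::chilbert cop \<Rightarrow> 'h cop" is "\<lambda>c T x. cscale c (T x)"
  by (rule bop_op_scale)

lift_definition star :: "'h::chilbert cop \<Rightarrow> 'h cop" is adj by (rule adj_props)

lemma ap_simps [simp]:
  "ap 0 x = 0" "ap 1 x = x" "ap (s + t) x = ap s x + ap t x" "ap (- t) x = - ap t x"
  "ap (s - t) x = ap s x - ap t x" "ap (s * t) x = ap s (ap t x)"
  "ap (r *\<^sub>R t) x = cscale (of_real r) (ap t x)" "ap (scC c t) x = cscale c (ap t x)"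
  by (transfer, simp)+

lemma ap_linear [simp]:
  "ap t (x + y) = ap t x + ap t y" "ap t (x - y) = ap t x - ap t y" "ap t 0 = 0"
  "ap t (- x) = - ap t x" "ap t (cscale c x) = cscale c (ap t x)"
  by (simp_all add: bop_ap bop_add bop_diff bop_zero bop_minus bop_scale)

lemma cinner_ap: "cinner (ap t x) y = cinner x (ap (star t) y)"
  by transfer (rule adj_props)

lemma star_eqI: "(\<And>x y. cinner (ap t x) y = cinner x (ap s y)) \<Longrightarrow> star t = s"
  by (rule cop_eqI) (metis cinner_ap cinner_ext_right)

lemma cinner_ap': "cinner x (ap t y) = cinner (ap (star t) x) y"
  using cinner_ap[of t y x] cinner_cnj[of x "ap t y"] cinner_cnj[of "ap (star t) x" y] by simp

lemma star_star [simp]: "star (star t) = t"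
  by (rule star_eqI) (rule cinner_ap'[symmetric])

lemma star_simps [simp]:
  "star 0 = 0" "star 1 = 1" "star (s + t) = star s + star t" "star (- t) = - star t"
  "star (s - t) = star s - star t" "star (s * t) = star t * star s"
  "star (r *\<^sub>R t) = r *\<^sub>R star t" "star (scC c t) = scC (cnj c) (star t)"
  by (rule star_eqI, simp add: cinner_simps cinner_ap)+

lemma scC_simps:
  "scC c t * s = scC c (t * s)" "s * scC c t = scC c (s * t)" "scC c (s + t) = scC c s + scC c t"
  "scC (c + d) t = scC c t + scC d t" "scC c (scC d t) = scC (c * d) t" "scC (of_real r) t = r *\<^sub>R t"
  "scC (-1) t = - t"
  by (rule cop_eqI, simp add: cscale_add_left cscale_add_right cscale_cscale cscale_minus_left cscale_one)+

text \<open>The operator order between hermitian elements is written below as a pointwise inequality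
  of these forms. For hermitian \<open>t\<close> taking the real part loses nothing, by
  \<open>Im_cinner_hermitian\<close>.\<close>

definition qf :: "'h::chilbert cop \<Rightarrow> 'h \<Rightarrow> real" where
  "qf t x = Re (cinner x (ap t x))"

lemma qf_simps [simp]:
  "qf 0 x = 0" "qf 1 x = (hnorm x)^2" "qf (s + t) x = qf s x + qf t x" "qf (- t) x = - qf t x"
  "qf (s - t) x = qf s x - qf t x" "qf (r *\<^sub>R t) x = r * qf t x"
  by (simp_all add: qf_def cinner_simps hnorm_sq)

lemma qf_sandwich: "qf (star t * s * t) x = qf s (ap t x)"
  by (simp add: qf_def cinner_ap)

lemma qf_square: "qf (star t * t) x = (hnorm (ap t x))^2"
  using qf_sandwich[of t 1 x] by simp

lemma Im_cinner_hermitian: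
  assumes "star t = t" shows "Im (cinner x (ap t x)) = 0"
  using cinner_cnj[of x "ap t x"] cinner_ap[of t x x] assms by (simp add: complex_eq_iff)

lemma qf_bounded: "\<exists>K>0. \<forall>x. qf t x \<le> K * (hnorm x)^2"
proof -
  obtain K where K: "0 \<le> K" "\<And>x. hnorm (ap t x) \<le> K * hnorm x"
    using bop_bound[OF bop_ap] by blast
  have "qf t x \<le> (K + 1) * (hnorm x)^2" for x
  proof -
    have "qf t x \<le> hnorm x * (K * hnorm x)"
      using Re_cinner_le[of x "ap t x"] mult_left_mono[OF K(2)[of x] hnorm_nonneg[of x]]
      by (simp add: qf_def)
    also have "\<dots> \<le> (K + 1) * (hnorm x)^2" by (simp add: power2_eq_square algebra_simps)
    finally show ?thesis .
  qed
  then show ?thesis using K(1) by (intro exI[of _ "K + 1"]) auto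
qed

lemma hlim_ap:
  assumes "hlim X l" shows "hlim (\<lambda>n. ap t (X n)) (ap t l)"
proof -
  obtain K where K: "\<And>x. hnorm (ap t x) \<le> K * hnorm x"
    using bop_bound[OF bop_ap] by blast
  have "(\<lambda>n. K * hnorm (X n - l)) \<longlonglongrightarrow> 0"
    using tendsto_mult_left[OF assms[unfolded hlim_def], of K] by simp
  then show ?thesis unfolding hlim_def
    by (rule Lim_null_comparison[rotated])
      (use K in \<open>auto intro!: always_eventually simp flip: ap_linear(2)\<close>)
qed

lemma tendsto_qf:
  assumes "hlim X l" shows "(\<lambda>n. qf t (X n)) \<longlonglongrightarrow> qf t l"
proof -
  have eq: "qf t (X n) = qf t (X n - l) + Re (cinner l (ap t (X n))) + Re (cinner (X n) (ap t l)) - qf t l" for n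
    by (simp add: qf_def cinner_simps)
  have "(\<lambda>n. qf t (X n - l)) \<longlonglongrightarrow> 0"
  proof -
    obtain K where K: "0 \<le> K" "\<And>x. hnorm (ap t x) \<le> K * hnorm x"
      using bop_bound[OF bop_ap] by blast
    have bound: "norm (qf t x) \<le> hnorm x * (K * hnorm x)" for x
      using Re_cinner_le[of x "ap t x"] mult_left_mono[OF K(2)[of x] hnorm_nonneg[of x]]
      by (simp add: qf_def)
    have "(\<lambda>n. hnorm (X n - l) * (K * hnorm (X n - l))) \<longlonglongrightarrow> 0 * (K * 0)"
      using assms unfolding hlim_def by (intro tendsto_intros)
    then have "(\<lambda>n. hnorm (X n - l) * (K * hnorm (X n - l))) \<longlonglongrightarrow> 0"
      by (simp only: mult_zero_left)
    then show ?thesis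
      by (rule Lim_null_comparison[rotated]) (intro always_eventually allI bound)
  qed
  moreover have "(\<lambda>n. Re (cinner l (ap t (X n)))) \<longlonglongrightarrow> qf t l"
    unfolding qf_def by (intro tendsto_Re hlim_cinner_right hlim_ap assms)
  moreover have "(\<lambda>n. Re (cinner (X n) (ap t l))) \<longlonglongrightarrow> qf t l"
    unfolding qf_def by (intro tendsto_Re hlim_cinner_left assms)
  ultimately have "(\<lambda>n. qf t (X n - l) + Re (cinner l (ap t (X n))) + Re (cinner (X n) (ap t l)) - qf t l)
      \<longlonglongrightarrow> 0 + qf t l + qf t l - qf t l"
    by (intro tendsto_intros)
  then show ?thesis by (simp flip: eq)
qed

text \<open>This is \<open>t^2 \<le> t\<close> for \<open>0 \<le> t \<le> 1\<close> without square
  roots: \<open>t (1 - t)^2 = t - 2 t^2 + t^3\<close> is positive, and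
  \<open>t^3 \<le> t^2\<close>.\<close>

lemma hnorm_ap_sq_le_qf:
  assumes "star t = t" "\<And>x. 0 \<le> qf t x" "\<And>x. qf t x \<le> (hnorm x)^2"
  shows "(hnorm (ap t x))^2 \<le> qf t x"
proof -
  have "0 \<le> qf t (x - ap t x)" by (rule assms)
  also have "qf t (x - ap t x) = qf t x - 2 * (hnorm (ap t x))^2 + qf t (ap t x)"
    using assms(1) by (simp add: qf_def cinner_simps hnorm_sq cinner_ap)
  also have "qf t (ap t x) \<le> (hnorm (ap t x))^2" by (rule assms)
  finally show ?thesis by simp
qed

section \<open>Resolvents of positive operators\<close>

lemma inverse_exists:
  assumes "star s = s" "\<And>x. 0 \<le> qf s x"
  shows "\<exists>r. (1 + s) * r = 1 \<and> r * (1 + s) = 1"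
proof -
  define w where "w = 1 + s"
  have w: "(hnorm x)^2 \<le> Re (cinner x (ap w x))" for x
    using assms(2)[of x] by (simp add: w_def qf_def cinner_simps hnorm_sq)
  have "star w = w" by (simp add: w_def assms(1))
  then have sym: "cinner (ap w x) y = cinner x (ap w y)" for x y
    using cinner_ap[of w x y] by simp
  have "\<exists>y. ap w y = x" for x
  proof -
    \<comment> \<open>Lax-Milgram for the functional \<open>cinner x\<close>; symmetry of
      \<open>w\<close> then turns the representing vector into a preimage of
      \<open>x\<close>.\<close>
    have "\<exists>y. \<forall>z. cinner x z = cinner y (ap w z)"
      by (rule lax_milgram[OF bop_ap sym w, of _ "hnorm x"])
        (use Re_cinner_le[of x] in \<open>auto simp: cinner_simps abs_le_iff\<close>)
    then obtain y where "\<And>z. cinner x z = cinner (ap w y) z" by (auto simp: sym)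
    then show ?thesis using cinner_ext_left by metis
  qed
  then obtain R where R: "\<And>x. ap w (R x) = x" by metis
  have inj: "x = y" if "ap w x = ap w y" for x y
  proof -
    have "hnorm (x - y) = 0" using w[of "x - y"] that by simp
    then show ?thesis by (simp add: hnorm_eq_zero)
  qed
  have "hnorm (R x) \<le> 1 * hnorm x" for x
  proof -
    have "(hnorm (R x))^2 \<le> hnorm (R x) * hnorm x"
      using w[of "R x"] Re_cinner_le[of "R x" x] by (simp add: R)
    then show ?thesis
      by (cases "hnorm (R x) = 0") (auto simp: power2_eq_square mult_le_cancel_left_pos less_le)
  qed
  moreover have "R (x + y) = R x + R y" "R (cscale c x) = cscale c (R x)" for x y c
    by (rule inj, simp add: R)+
  ultimately have "bop R" by (intro bopI)
  then have ap_R: "ap (Cop R) = R" by (simp add: Cop_inverse)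
  have "w * Cop R = 1" by (rule cop_eqI) (simp add: ap_R R)
  moreover have "Cop R * w = 1" by (rule cop_eqI, rule inj) (simp add: ap_R R)
  ultimately show ?thesis unfolding w_def by blast
qed

text \<open>The inverse of \<open>1 + s\<close>, meaningful for hermitian positive \<open>s\<close>.
  It stays between 0 and 1 however large \<open>s\<close> is, which makes it usable for sums without
  a uniform bound.\<close>

definition resolvent :: "'h::chilbert cop \<Rightarrow> 'h cop" where
  "resolvent s = (SOME r. (1 + s) * r = 1 \<and> r * (1 + s) = 1)"

context
  fixes s :: "'h::chilbert cop"
  assumes s: "star s = s" "\<And>x. 0 \<le> qf s x"
begin

lemma resolvent_mult: "(1 + s) * resolvent s = 1" "resolvent s * (1 + s) = 1"
  using someI_ex[OF inverse_exists[OF s]] by (auto simp: resolvent_def)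

lemma star_resolvent: "star (resolvent s) = resolvent s"
proof -
  have "star (resolvent s) * (1 + s) = 1"
    using arg_cong[OF resolvent_mult(1), of star] s(1) by simp
  then have "star (resolvent s) = star (resolvent s) * ((1 + s) * resolvent s)"
    by (simp add: resolvent_mult)
  also have "\<dots> = resolvent s"
    unfolding mult.assoc[symmetric] by (simp add: \<open>star (resolvent s) * (1 + s) = 1\<close>)
  finally show ?thesis .
qed

lemma ap_resolvent: "ap (1 + s) (ap (resolvent s) x) = x"
  using arg_cong[OF resolvent_mult(1), of "\<lambda>t. ap t x"] by simp

lemma qf_resolvent: "qf (resolvent s) x = qf (1 + s) (ap (resolvent s) x)"
  using Re_cinner_commute[of x "ap (resolvent s) x"] by (simp add: qf_def ap_resolvent del: ap_simps)

lemma qf_resolvent_nonneg: "0 \<le> qf (resolvent s) x"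
  using s(2) by (simp add: qf_resolvent)

text \<open>Half of the variational formula: the form of the resolvent at \<open>x\<close> is the
  maximum of the left side over \<open>y\<close>, attained at \<open>z\<close>. The proof completes
  the square around \<open>z\<close>.\<close>

lemma qf_resolvent_ge: "2 * Re (cinner x y) - qf (1 + s) y \<le> qf (resolvent s) x"
proof -
  define z where "z = ap (resolvent s) x"
  have x: "x = ap (1 + s) z" by (simp add: z_def ap_resolvent del: ap_simps)
  have "0 \<le> qf (1 + s) (y - z)" using s(2) by simp
  also have "qf (1 + s) (y - z) = qf (1 + s) y - 2 * Re (cinner x y) + qf (1 + s) z"
  proof -
    have "Re (cinner y (ap (1 + s) z)) = Re (cinner (ap (1 + s) z) y)" by (rule Re_cinner_commute)
    moreover have "Re (cinner z (ap (1 + s) y)) = Re (cinner (ap (1 + s) z) y)"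
      using s(1) by (simp only: cinner_ap star_simps)
    ultimately show ?thesis
      unfolding x qf_def ap_linear(2) cinner_diff_left cinner_diff_right by simp
  qed
  finally show ?thesis by (simp add: qf_resolvent z_def del: qf_simps)
qed

lemma qf_resolvent_le: "qf (resolvent s) x \<le> (hnorm x)^2"
proof -
  have "(hnorm (ap (resolvent s) x))^2 \<le> qf (resolvent s) x"
    using s(2)[of "ap (resolvent s) x"] by (simp add: qf_resolvent)
  moreover have "0 \<le> (hnorm (x - ap (resolvent s) x))^2" by simp
  then have "0 \<le> (hnorm x)^2 - 2 * qf (resolvent s) x + (hnorm (ap (resolvent s) x))^2"
    using Re_cinner_commute[of x "ap (resolvent s) x"] unfolding hnorm_sq qf_def
    by (simp add: cinner_simps)
  ultimately show ?thesis by linarith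
qed

text \<open>The right side is a sandwich of a positive operator, so this exhibits
  \<open>1 - resolvent s \<le> s\<close>, the operator form of
  \<open>t / (1 + t) \<le> t\<close>.\<close>

lemma resolvent_diff: "s - (1 - resolvent s) = s * resolvent s * s"
proof -
  have 1: "resolvent s * s = 1 - resolvent s" using resolvent_mult(2) by (simp add: algebra_simps)
  have 2: "s * resolvent s = 1 - resolvent s" using resolvent_mult(1) by (simp add: algebra_simps)
  have "s * resolvent s * s = s - resolvent s * s" unfolding 2 by (simp add: algebra_simps)
  then show ?thesis unfolding 1 by simp
qed

end

text \<open>In the variational formula a larger operator lowers the value at every competitor, so
  inversion reverses the order.\<close>

lemma qf_resolvent_antimono:
  assumes "star s = s" "\<And>x. 0 \<le> qf s x" "star t = t" "\<And>x. qf s x \<le> qf t x"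
  shows "qf (resolvent t) x \<le> qf (resolvent s) x"
proof -
  have t: "0 \<le> qf t x" for x using assms(2,4) order_trans by blast
  define y where "y = ap (resolvent t) x"
  have "qf (resolvent t) x = 2 * Re (cinner x y) - qf (1 + t) y"
    using qf_resolvent[OF assms(3) t, of x] by (simp add: y_def qf_def del: ap_simps)
  also have "\<dots> \<le> 2 * Re (cinner x y) - qf (1 + s) y" using assms(4) by simp
  also have "\<dots> \<le> qf (resolvent s) x" by (rule qf_resolvent_ge[OF assms(1,2)])
  finally show ?thesis .
qed

lemma commute_resolvent:
  assumes "star s = s" "\<And>x. 0 \<le> qf s x" "u * s = s * u"
  shows "u * resolvent s = resolvent s * u"
proof -
  have "u * resolvent s = resolvent s * (1 + s) * u * resolvent s"
    by (simp add: resolvent_mult[OF assms(1,2)])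
  also have "\<dots> = resolvent s * ((1 + s) * u) * resolvent s"
    by (simp only: mult.assoc)
  also have "(1 + s) * u = u * (1 + s)"
    using assms(3) by (simp add: algebra_simps)
  also have "resolvent s * (u * (1 + s)) * resolvent s = resolvent s * u * ((1 + s) * resolvent s)"
    by (simp only: mult.assoc)
  finally show ?thesis by (simp add: resolvent_mult[OF assms(1,2)])
qed

section \<open>Strong limits of bounded monotone sequences\<close>

lemma monotone_limit:
  fixes T :: "nat \<Rightarrow> 'h::chilbert cop"
  assumes T: "\<And>n. star (T n) = T n" "\<And>n x. 0 \<le> qf (T n) x" "\<And>n x. qf (T n) x \<le> (hnorm x)^2"
    and mono: "\<And>n x. qf (T n) x \<le> qf (T (Suc n)) x"
  shows "\<exists>t. star t = t \<and> (\<forall>x. hlim (\<lambda>n. ap (T n) x) (ap t x))"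
proof -
  have "\<exists>l. hlim (\<lambda>n. ap (T n) x) l" for x
  proof -
    have inc: "incseq (\<lambda>n. qf (T n) x)" using mono by (auto intro: incseq_SucI)
    obtain L where L: "(\<lambda>n. qf (T n) x) \<longlonglongrightarrow> L" "\<And>n. qf (T n) x \<le> L"
      using incseq_convergent[OF inc, of "(hnorm x)^2"] T(3) by auto
    show ?thesis
    proof (rule hlim_exists[where b="\<lambda>n. L - qf (T n) x"])
      fix m n :: nat assume "n \<le> m"
      have "qf (T n) y \<le> qf (T m) y" for y
        using lift_Suc_mono_le[of "\<lambda>n. qf (T n) y", OF mono \<open>n \<le> m\<close>] .
      \<comment> \<open>\<open>T m - T n\<close> lies between 0 and 1, so convergence of the form
        values upgrades to norm convergence of the vectors.\<close>
      then have "(hnorm (ap (T m - T n) x))^2 \<le> qf (T m - T n) x"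
        by (intro hnorm_ap_sq_le_qf)
          (auto simp: T(1) diff_le_eq intro: add_increasing2 T)
      then show "(hnorm (ap (T m) x - ap (T n) x))^2 \<le> L - qf (T n) x"
        using L(2)[of m] by simp
    next
      show "(\<lambda>n. L - qf (T n) x) \<longlonglongrightarrow> 0"
        using tendsto_diff[OF tendsto_const L(1), of L] by simp
    qed
  qed
  then obtain S where S: "\<And>x. hlim (\<lambda>n. ap (T n) x) (S x)" by metis
  have lim: "(\<lambda>n. cinner y (ap (T n) x)) \<longlonglongrightarrow> cinner y (S x)" for x y
    by (rule hlim_cinner_right[OF S])
  have uniq: "S x = z" if "\<And>y. (\<lambda>n. cinner y (ap (T n) x)) \<longlonglongrightarrow> cinner y z" for x z
    by (rule cinner_ext_right) (use LIMSEQ_unique[OF lim that] in blast)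
  have "S (x + y) = S x + S y" for x y
    by (rule uniq) (simp add: cinner_simps tendsto_add lim)
  moreover have "S (cscale c x) = cscale c (S x)" for c x
    by (rule uniq) (simp add: cinner_simps tendsto_mult lim)
  moreover have "hnorm (S x) \<le> 1 * hnorm x" for x
  proof -
    have "hnorm (ap (T n) x) \<le> hnorm x" for n
      using hnorm_ap_sq_le_qf[OF T(1) T(2) T(3), of n x] T(3)[of n x]
      by (meson hnorm_nonneg order_trans power2_le_imp_le)
    then have "Re (cinner (S x) (ap (T n) x)) \<le> hnorm (S x) * hnorm x" for n
      using Re_cinner_le[of "S x" "ap (T n) x"] mult_left_mono[OF _ hnorm_nonneg[of "S x"]]
      by (meson abs_le_D1 order_trans)
    then have "Re (cinner (S x) (S x)) \<le> hnorm (S x) * hnorm x"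
      by (intro LIMSEQ_le_const2[OF tendsto_Re[OF lim]]) auto
    then have "hnorm (S x) * hnorm (S x) \<le> hnorm (S x) * hnorm x"
      by (simp add: hnorm_sq[symmetric] power2_eq_square)
    then show ?thesis
      by (cases "hnorm (S x) = 0") (auto simp: mult_le_cancel_left_pos less_le)
  qed
  ultimately have "bop S" by (intro bopI)
  then have ap_S: "ap (Cop S) = S" by (simp add: Cop_inverse)
  have "star (Cop S) = Cop S"
  proof (rule star_eqI)
    fix x y
    have "(\<lambda>n. cinner x (ap (T n) y)) \<longlonglongrightarrow> cinner (S x) y"
      using hlim_cinner_left[OF S, of x y] by (simp add: cinner_ap T(1))
    then show "cinner (ap (Cop S) x) y = cinner x (ap (Cop S) y)"
      unfolding ap_S using LIMSEQ_unique[OF lim] by metis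
  qed
  then show ?thesis using S ap_S by metis
qed

lemma commute_limit:
  assumes "\<And>n. u * T n = T n * u" "\<And>x. hlim (\<lambda>n. ap (T n) x) (ap t x)"
  shows "u * t = t * u"
proof (rule cop_eqI, rule cinner_ext_right)
  fix x y
  have "ap u (ap (T n) x) = ap (T n) (ap u x)" for n
    using arg_cong[OF assms(1)[of n], of "\<lambda>t. ap t x"] by simp
  then have "(\<lambda>n. cinner y (ap (T n) (ap u x))) \<longlonglongrightarrow> cinner y (ap u (ap t x))"
    using hlim_cinner_right[OF hlim_ap[OF assms(2)[of x], of u], of y] by simp
  from LIMSEQ_unique[OF this hlim_cinner_right[OF assms(2)]]
  show "cinner y (ap (u * t) x) = cinner y (ap (t * u) x)" by simp
qed

section \<open>Faithful normal states\<close>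

text \<open>The \<open>incseq\<close> premise of \<open>normal\<close> breaks a circle: \<mu> is
  positive on squares by definition, but its monotonicity in the operator order
  (\<open>mu_mono\<close>) is derived from \<open>mu_square_le\<close>, which itself uses
  \<open>normal\<close>. Closure under strong limits and resolvents enters through
  \<open>bicommutant\<close>.\<close>

locale vn_state =
  fixes A :: "'h::chilbert cop set" and \<mu> :: "'h cop \<Rightarrow> complex"
  assumes one_closed [simp]: "1 \<in> A"
    and add_closed [simp]: "s \<in> A \<Longrightarrow> t \<in> A \<Longrightarrow> s + t \<in> A"
    and mult_closed [simp]: "s \<in> A \<Longrightarrow> t \<in> A \<Longrightarrow> s * t \<in> A"
    and scC_closed [simp]: "t \<in> A \<Longrightarrow> scC c t \<in> A"
    and star_closed [simp]: "t \<in> A \<Longrightarrow> star t \<in> A"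
    and bicommutant: "(\<And>u. (\<And>t. t \<in> A \<Longrightarrow> u * t = t * u) \<Longrightarrow> u * r = r * u) \<Longrightarrow> r \<in> A"
    and mu_add: "s \<in> A \<Longrightarrow> t \<in> A \<Longrightarrow> \<mu> (s + t) = \<mu> s + \<mu> t"
    and mu_scC: "t \<in> A \<Longrightarrow> \<mu> (scC c t) = c * \<mu> t"
    and mu_one: "\<mu> 1 = 1"
    and mu_square: "t \<in> A \<Longrightarrow> cpos (\<mu> (star t * t))"
    and faithful: "t \<in> A \<Longrightarrow> \<mu> (star t * t) = 0 \<Longrightarrow> t = 0"
    and normal: "(\<And>n. T n \<in> A) \<Longrightarrow> (\<And>n. star (T n) = T n) \<Longrightarrow> (\<And>n x. 0 \<le> qf (T n) x) \<Longrightarrow>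
      (\<And>n x. qf (T n) x \<le> qf (T (Suc n)) x) \<Longrightarrow> t \<in> A \<Longrightarrow> star t = t \<Longrightarrow>
      (\<And>x. hlim (\<lambda>n. ap (T n) x) (ap t x)) \<Longrightarrow> incseq (\<lambda>n. Re (\<mu> (T n))) \<Longrightarrow> (\<lambda>n. Re (\<mu> (T n))) \<longlonglongrightarrow> Re (\<mu> t)"
begin

lemma scaleR_closed [simp]: "t \<in> A \<Longrightarrow> r *\<^sub>R t \<in> A"
  using scC_closed[of t "of_real r"] by (simp add: scC_simps)

lemma uminus_closed [simp]: "t \<in> A \<Longrightarrow> - t \<in> A"
  using scC_closed[of t "-1"] by (simp add: scC_simps)

lemma diff_closed [simp]: "s \<in> A \<Longrightarrow> t \<in> A \<Longrightarrow> s - t \<in> A"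
  using add_closed[of s "- t"] by simp

lemma zero_closed [simp]: "0 \<in> A"
  using diff_closed[OF one_closed one_closed] by simp

lemma sum_closed: "(\<And>i. i \<in> I \<Longrightarrow> f i \<in> A) \<Longrightarrow> sum f I \<in> A"
  by (induction I rule: infinite_finite_induct) auto

lemma mu_scaleR: "t \<in> A \<Longrightarrow> \<mu> (r *\<^sub>R t) = r * \<mu> t"
  using mu_scC[of t "of_real r"] by (simp add: scC_simps)

lemma mu_minus: "t \<in> A \<Longrightarrow> \<mu> (- t) = - \<mu> t"
  using mu_scC[of t "-1"] by (simp add: scC_simps)

lemma mu_diff: "s \<in> A \<Longrightarrow> t \<in> A \<Longrightarrow> \<mu> (s - t) = \<mu> s - \<mu> t"
  using mu_add[of s "- t"] by (simp add: mu_minus)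

lemma mu_zero: "\<mu> 0 = 0"
  using mu_diff[OF one_closed one_closed] by simp

lemma mu_sum: "(\<And>i. i \<in> I \<Longrightarrow> f i \<in> A) \<Longrightarrow> \<mu> (sum f I) = (\<Sum>i\<in>I. \<mu> (f i))"
  by (induction I rule: infinite_finite_induct) (auto simp: mu_add mu_zero sum_closed)

lemmas mu_simps = mu_add mu_diff mu_minus mu_scaleR mu_scC mu_one mu_zero

lemma Re_mu_square: "t \<in> A \<Longrightarrow> 0 \<le> Re (\<mu> (star t * t))"
  using mu_square by (auto simp: cpos_def)

lemma mu_star: assumes t: "t \<in> A" shows "\<mu> (star t) = cnj (\<mu> t)"
proof -
  \<comment> \<open>The value at the square of \<open>1 + s\<close> is real, and so are the values
    at 1 and at \<open>star s * s\<close>; the mixed terms remain. Applied to \<open>t\<close> and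
    to \<open>\<i> t\<close>, this gives both parts of the claim.\<close>
  have real: "Im (\<mu> (star s) + \<mu> s) = 0" if "s \<in> A" for s
  proof -
    have "star (1 + s) * (1 + s) = 1 + (star s + s) + star s * s" by (simp add: algebra_simps)
    then show ?thesis
      using mu_square[of "1 + s"] mu_square[of s] that by (simp add: cpos_def mu_simps)
  qed
  have "Im (\<mu> (star t) + \<mu> t) = 0" "Im (\<mu> (star (scC \<i> t)) + \<mu> (scC \<i> t)) = 0"
    using t by (intro real; simp)+
  then show ?thesis using t by (simp add: complex_eq_iff mu_simps)
qed

lemma mu_cauchy_schwarz:
  assumes "s \<in> A" "t \<in> A"
  shows "(Re (\<mu> (star s * t)))^2 \<le> Re (\<mu> (star s * s)) * Re (\<mu> (star t * t))"
proof (rule quadratic_nonneg_discriminant)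
  fix r :: real
  have "star (s + r *\<^sub>R t) * (s + r *\<^sub>R t)
      = star s * s + r *\<^sub>R (star s * t + star (star s * t)) + r^2 *\<^sub>R (star t * t)"
    by (simp add: algebra_simps power2_eq_square)
  then have "\<mu> (star (s + r *\<^sub>R t) * (s + r *\<^sub>R t))
      = \<mu> (star s * s) + r * (\<mu> (star s * t) + cnj (\<mu> (star s * t))) + r^2 * \<mu> (star t * t)"
    using assms mu_star[of "star s * t"] by (simp add: mu_simps)
  with Re_mu_square[of "s + r *\<^sub>R t"] assms
  show "0 \<le> Re (\<mu> (star s * s)) + 2 * r * Re (\<mu> (star s * t)) + r^2 * Re (\<mu> (star t * t))"
    by (simp add: complex_add_cnj)
qed (use assms Re_mu_square in auto)

lemma limit_closed:
  assumes "\<And>n. T n \<in> A" "\<And>x. hlim (\<lambda>n. ap (T n) x) (ap t x)"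
  shows "t \<in> A"
  by (rule bicommutant, rule commute_limit[OF _ assms(2)]) (use assms(1) in blast)

lemma resolvent_closed:
  assumes "s \<in> A" "star s = s" "\<And>x. 0 \<le> qf s x"
  shows "resolvent s \<in> A"
  by (rule bicommutant, rule commute_resolvent[OF assms(2,3)]) (use assms(1) in blast)

text \<open>By normality, since \<open>y\<close> is the increasing limit of the sums
  \<open>y\<^sub>0\<^sup>2 + \<dots> + y\<^sub>n\<^sup>2\<close>, where \<open>y\<^sub>0 = y\<close> and \<open>y\<^sub>n\<^sub>+\<^sub>1 = y\<^sub>n - y\<^sub>n\<^sup>2\<close>. This avoids square roots of positive operators.\<close>

lemma mu_square_le:
  assumes y: "y \<in> A" "star y = y" "\<And>x. 0 \<le> qf y x" "\<And>x. qf y x \<le> (hnorm x)^2"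
  shows "Re (\<mu> (y * y)) \<le> Re (\<mu> y)"
proof -
  define Y where "Y = rec_nat y (\<lambda>_ z. z - z * z)"
  have Y0: "Y 0 = y" and YS: "\<And>n. Y (Suc n) = Y n - Y n * Y n" by (simp_all add: Y_def)
  \<comment> \<open>The iteration stays between 0 and 1 because \<open>0 \<le> y^2 \<le> y\<close>
    there.\<close>
  have Y: "Y n \<in> A \<and> star (Y n) = Y n \<and> (\<forall>x. 0 \<le> qf (Y n) x) \<and> (\<forall>x. qf (Y n) x \<le> (hnorm x)^2)" for n
  proof (induction n)
    case 0 show ?case using y by (simp add: Y0)
  next
    case (Suc n)
    have "qf (Y n * Y n) x = (hnorm (ap (Y n) x))^2" for x using qf_square[of "Y n" x] Suc by simp
    moreover have "(hnorm (ap (Y n) x))^2 \<le> qf (Y n) x" for x using Suc by (intro hnorm_ap_sq_le_qf) auto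
    moreover have "qf (Y n) x - (hnorm (ap (Y n) x))^2 \<le> (hnorm x)^2" for x
      using Suc by (simp add: diff_le_eq add_increasing2)
    ultimately show ?case using Suc by (simp add: YS)
  qed
  have step: "qf (Y (Suc n)) x = qf (Y n) x - (hnorm (ap (Y n) x))^2" for n x
    using qf_square[of "Y n" x] Y[of n] by (simp add: YS)
  have dec: "decseq (\<lambda>n. qf (Y n) x)" for x by (rule decseq_SucI) (simp add: step)
  have Y_null: "(\<lambda>n. hnorm (ap (Y n) x)) \<longlonglongrightarrow> 0" for x
  proof -
    obtain L where L: "(\<lambda>n. qf (Y n) x) \<longlonglongrightarrow> L"
      by (rule decseq_convergent[OF dec[of x], of 0]) (use Y in auto)
    have "(\<lambda>n. qf (Y n) x - qf (Y (Suc n)) x) \<longlonglongrightarrow> L - L"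
      by (intro tendsto_diff L LIMSEQ_Suc[OF L])
    then have "(\<lambda>n. (hnorm (ap (Y n) x))^2) \<longlonglongrightarrow> 0" by (simp add: step)
    then have "(\<lambda>n. sqrt ((hnorm (ap (Y n) x))^2)) \<longlonglongrightarrow> sqrt 0" by (rule tendsto_real_sqrt)
    then show ?thesis by simp
  qed
  \<comment> \<open>Each increment is a square, so only the defining positivity of \<mu> is
    used.\<close>
  have inc: "incseq (\<lambda>n. Re (\<mu> (y - Y n)))"
  proof (rule incseq_SucI)
    fix n
    have "y - Y (Suc n) = (y - Y n) + star (Y n) * Y n"
      using Y[of n] by (simp add: YS)
    then have "Re (\<mu> (y - Y (Suc n))) = Re (\<mu> (y - Y n)) + Re (\<mu> (star (Y n) * Y n))"
      using Y[of n] y(1) by (simp only: mu_add diff_closed mult_closed star_closed plus_complex.sel)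
    then show "Re (\<mu> (y - Y n)) \<le> Re (\<mu> (y - Y (Suc n)))"
      using Re_mu_square[of "Y n"] Y[of n] by simp
  qed
  have "(\<lambda>n. Re (\<mu> (y - Y n))) \<longlonglongrightarrow> Re (\<mu> y)"
  proof (rule normal)
    show "0 \<le> qf (y - Y n) x" for n x using decseqD[OF dec, of 0 n x] by (simp add: Y0)
    show "qf (y - Y n) x \<le> qf (y - Y (Suc n)) x" for n x by (simp add: step)
    show "hlim (\<lambda>n. ap (y - Y n) x) (ap y x)" for x
      using Y_null[of x] by (simp add: hlim_def hnorm_minus)
  qed (use Y y inc in auto)
  \<comment> \<open>Index 1 is the relevant one: \<open>y - Y 1\<close> is exactly
    \<open>y * y\<close>.\<close>
  from incseq_le[OF inc this, of 1] show ?thesis by (simp add: YS Y0)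
qed

text \<open>Rescaling \<open>t\<close> into the unit interval gives
  \<open>0 \<le> \<mu>(y^2) \<le> \<mu>(y)\<close>. This carries both positivity and faithfulness
  from squares to elements that are positive as operators.\<close>

lemma mu_pos:
  assumes t: "t \<in> A" "star t = t" "\<And>x. 0 \<le> qf t x"
  shows "0 \<le> Re (\<mu> t)"
    and "Re (\<mu> t) \<le> 0 \<Longrightarrow> t = 0"
proof -
  obtain K where K: "K > 0" "\<And>x. qf t x \<le> K * (hnorm x)^2" using qf_bounded[of t] by blast
  define y where "y = (1 / K) *\<^sub>R t"
  have y: "y \<in> A" "star y = y" "\<And>x. 0 \<le> qf y x" "\<And>x. qf y x \<le> (hnorm x)^2"
    using t K by (auto simp: y_def divide_simps mult.commute)
  have "0 \<le> Re (\<mu> (star y * y))" by (rule Re_mu_square[OF y(1)])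
  also have "\<dots> \<le> Re (\<mu> y)" using mu_square_le[OF y] y(2) by simp
  finally have 1: "0 \<le> Re (\<mu> (star y * y))" "Re (\<mu> (star y * y)) \<le> Re (\<mu> y)" "0 \<le> Re (\<mu> y)"
    using Re_mu_square[OF y(1)] mu_square_le[OF y] y(2) by simp_all
  have mu_y: "Re (\<mu> y) = Re (\<mu> t) / K" using t by (simp add: y_def mu_simps)
  show "0 \<le> Re (\<mu> t)" using 1 K unfolding mu_y by (simp add: zero_le_divide_iff)
  assume "Re (\<mu> t) \<le> 0"
  then have "Re (\<mu> y) \<le> 0" using K by (simp add: mu_y divide_nonpos_pos)
  then have "\<mu> (star y * y) = 0" using 1 mu_square[OF y(1)] by (simp add: cpos_def complex_eq_iff)
  then have "y = 0" using faithful y(1) by blast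
  then show "t = 0" using K by (simp add: y_def)
qed

lemma mu_mono:
  assumes "s \<in> A" "t \<in> A" "star s = s" "star t = t" "\<And>x. qf s x \<le> qf t x"
  shows "Re (\<mu> s) \<le> Re (\<mu> t)"
  using mu_pos(1)[of "t - s"] assms by (simp add: mu_simps)

lemma increasing_limit:
  assumes T: "\<And>n. T n \<in> A" "\<And>n. star (T n) = T n" "\<And>n x. 0 \<le> qf (T n) x" "\<And>n x. qf (T n) x \<le> (hnorm x)^2"
    and mono: "\<And>n x. qf (T n) x \<le> qf (T (Suc n)) x"
  shows "\<exists>t. t \<in> A \<and> star t = t \<and> (\<forall>x. 0 \<le> qf t x) \<and> (\<forall>x. qf t x \<le> (hnorm x)^2) \<and>
    (\<forall>x. hlim (\<lambda>n. ap (T n) x) (ap t x)) \<and> (\<lambda>n. Re (\<mu> (T n))) \<longlonglongrightarrow> Re (\<mu> t)"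
proof -
  obtain t where t: "star t = t" "\<And>x. hlim (\<lambda>n. ap (T n) x) (ap t x)"
    using monotone_limit[of T] T(2-4) mono by blast
  have "t \<in> A" by (rule limit_closed[OF T(1) t(2)])
  have lim: "(\<lambda>n. qf (T n) x) \<longlonglongrightarrow> qf t x" for x
    unfolding qf_def by (intro tendsto_Re hlim_cinner_right t)
  have "0 \<le> qf t x" for x using T(3) by (intro LIMSEQ_le_const[OF lim]) auto
  moreover have "qf t x \<le> (hnorm x)^2" for x using T(4) by (intro LIMSEQ_le_const2[OF lim]) auto
  moreover have "incseq (\<lambda>n. Re (\<mu> (T n)))"
    using T mono by (intro incseq_SucI mu_mono) auto
  then have "(\<lambda>n. Re (\<mu> (T n))) \<longlonglongrightarrow> Re (\<mu> t)"
    by (intro normal) (use T mono \<open>t \<in> A\<close> t in auto)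
  ultimately show ?thesis using t \<open>t \<in> A\<close> by blast
qed

lemma decreasing_limit:
  assumes T: "\<And>n. T n \<in> A" "\<And>n. star (T n) = T n" "\<And>n x. 0 \<le> qf (T n) x" "\<And>n x. qf (T n) x \<le> (hnorm x)^2"
    and anti: "\<And>n x. qf (T (Suc n)) x \<le> qf (T n) x"
  shows "\<exists>t. t \<in> A \<and> star t = t \<and> (\<forall>x. 0 \<le> qf t x) \<and> (\<forall>x. qf t x \<le> (hnorm x)^2) \<and>
    (\<forall>x. hlim (\<lambda>n. ap (T n) x) (ap t x)) \<and> (\<lambda>n. Re (\<mu> (T n))) \<longlonglongrightarrow> Re (\<mu> t)"
proof -
  have "\<exists>t. t \<in> A \<and> star t = t \<and> (\<forall>x. 0 \<le> qf t x) \<and> (\<forall>x. qf t x \<le> (hnorm x)^2) \<and>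
    (\<forall>x. hlim (\<lambda>n. ap (1 - T n) x) (ap t x)) \<and> (\<lambda>n. Re (\<mu> (1 - T n))) \<longlonglongrightarrow> Re (\<mu> t)"
    by (rule increasing_limit) (use T anti in auto)
  then obtain t where t: "t \<in> A" "star t = t" "\<And>x. 0 \<le> qf t x" "\<And>x. qf t x \<le> (hnorm x)^2"
    "\<And>x. hlim (\<lambda>n. ap (1 - T n) x) (ap t x)" "(\<lambda>n. Re (\<mu> (1 - T n))) \<longlonglongrightarrow> Re (\<mu> t)" by blast
  have "hlim (\<lambda>n. ap (T n) x) (ap (1 - t) x)" for x
  proof -
    have "hnorm (ap (T n) x - ap (1 - t) x) = hnorm (ap (1 - T n) x - ap t x)" for n
      using hnorm_minus[of "ap (T n) x - ap (1 - t) x"] by (simp add: algebra_simps)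
    with t(5)[of x] show ?thesis by (simp only: hlim_def)
  qed
  moreover have "(\<lambda>n. Re (\<mu> (T n))) \<longlonglongrightarrow> Re (\<mu> (1 - t))"
    using tendsto_diff[OF tendsto_const t(6), of 1] T(1) t(1) by (simp add: mu_simps)
  ultimately show ?thesis using t(1-4) by (intro exI[of _ "1 - t"]) auto
qed

lemma sum_half_powers: "(\<Sum>k\<in>{n..<m}. (1/2::real)^k) \<le> 2 * (1/2)^n"
proof -
  have eq: "(\<Sum>k\<in>{n..<n+j}. (1/2::real)^k) + 2 * (1/2)^(n+j) = 2 * (1/2)^n" for j
    by (induction j) (simp_all add: field_simps)
  show ?thesis
  proof (cases "n \<le> m")
    case True
    then obtain j where m: "m = n + j" using le_Suc_ex by blast
    have "0 \<le> 2 * (1/2::real)^(n+j)" by simp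
    with eq[of j] show ?thesis unfolding m by linarith
  qed simp
qed

text \<open>The resolvents of the sums \<open>e\<^sub>n + \<dots> + e\<^sub>m\<close> tend to 1, strongly, when first \<open>m\<close> and then \<open>n\<close>
  tends to infinity; this bounds \<open>a\<close> although the \<open>e\<^sub>n\<close> need not be bounded.\<close>

lemma nonpos_of_dominated:
  assumes a: "a \<in> A" "star a = a"
    and e: "\<And>n. e n \<in> A" "\<And>n. star (e n) = e n" "\<And>n x. 0 \<le> qf (e n) x"
      "\<And>n x. qf a x \<le> qf (e n) x" "\<And>n. Re (\<mu> (e n)) \<le> C * (1/2)^n"
  shows "qf a x \<le> 0"
proof -
  define s where "s n m = sum e {n..<m}" for n m
  define r where "r n m = resolvent (s n m)" for n m
  have qf_s: "qf (s n m) x = (\<Sum>k\<in>{n..<m}. qf (e k) x)" for n m x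
    unfolding s_def by (induction m) (auto simp: atLeastLessThanSuc)
  have s: "s n m \<in> A" "star (s n m) = s n m" "0 \<le> qf (s n m) x" for n m x
  proof -
    show "s n m \<in> A" unfolding s_def by (intro sum_closed e)
    show "star (s n m) = s n m" unfolding s_def by (induction m) (auto simp: atLeastLessThanSuc e)
    show "0 \<le> qf (s n m) x" unfolding qf_s by (intro sum_nonneg e)
  qed
  have s_mono: "qf (s n m) x \<le> qf (s n' m') x" if "n' \<le> n" "m \<le> m'" for n m n' m' x
    unfolding qf_s using that e(3) by (intro sum_mono2) auto
  have C: "0 \<le> C"
    using e(5)[of 0] mu_pos(1)[OF e(1-3), of 0] by simp
  have r: "r n m \<in> A" "star (r n m) = r n m" "0 \<le> qf (r n m) x" "qf (r n m) x \<le> (hnorm x)^2" for n m x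
    unfolding r_def using s
    by (auto intro!: resolvent_closed star_resolvent qf_resolvent_nonneg qf_resolvent_le)
  have r_anti: "qf (r n' m') x \<le> qf (r n m) x" if "n' \<le> n" "m \<le> m'" for n m n' m' x
    unfolding r_def by (rule qf_resolvent_antimono[OF s(2,3,2) s_mono[OF that]])
  \<comment> \<open>From \<open>1 - r \<le> s\<close> and the geometric series. The bound does not
    involve \<open>m\<close>, so it survives the limit in \<open>m\<close>.\<close>
  have mu_r: "1 - 2 * C * (1/2)^n \<le> Re (\<mu> (r n m))" for n m
  proof -
    have "s n m - (1 - r n m) = star (s n m) * r n m * s n m"
      using resolvent_diff[OF s(2,3)] by (simp add: r_def s)
    then have "0 \<le> qf (s n m - (1 - r n m)) x" for x
      by (simp only: qf_sandwich r)
    then have "Re (\<mu> (1 - r n m)) \<le> Re (\<mu> (s n m))"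
      using s r by (intro mu_mono) auto
    also have "\<dots> = (\<Sum>k\<in>{n..<m}. Re (\<mu> (e k)))" by (simp add: s_def mu_sum e)
    also have "\<dots> \<le> (\<Sum>k\<in>{n..<m}. C * (1/2)^k)" by (intro sum_mono e)
    also have "\<dots> = C * (\<Sum>k\<in>{n..<m}. (1/2)^k)" by (simp add: sum_distrib_left)
    also have "\<dots> \<le> C * (2 * (1/2)^n)" by (intro mult_left_mono sum_half_powers C)
    finally show ?thesis using r(1) by (simp add: mu_simps)
  qed
  have "\<exists>t. t \<in> A \<and> star t = t \<and> (\<forall>x. 0 \<le> qf t x) \<and> (\<forall>x. qf t x \<le> (hnorm x)^2) \<and>
    (\<forall>x. hlim (\<lambda>m. ap (r n m) x) (ap t x)) \<and> (\<lambda>m. Re (\<mu> (r n m))) \<longlonglongrightarrow> Re (\<mu> t)" for n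
    by (rule decreasing_limit) (auto intro: r r_anti)
  then obtain R where R: "\<And>n. R n \<in> A" "\<And>n. star (R n) = R n" "\<And>n x. 0 \<le> qf (R n) x"
    "\<And>n x. qf (R n) x \<le> (hnorm x)^2" and lim_r: "\<And>n x. hlim (\<lambda>m. ap (r n m) x) (ap (R n) x)"
    "\<And>n. (\<lambda>m. Re (\<mu> (r n m))) \<longlonglongrightarrow> Re (\<mu> (R n))" by metis
  have lim_qf: "(\<lambda>m. qf (r n m) x) \<longlonglongrightarrow> qf (R n) x" for n x
    unfolding qf_def by (intro tendsto_Re hlim_cinner_right lim_r)
  have "\<exists>t. t \<in> A \<and> star t = t \<and> (\<forall>x. 0 \<le> qf t x) \<and> (\<forall>x. qf t x \<le> (hnorm x)^2) \<and>
    (\<forall>x. hlim (\<lambda>n. ap (R n) x) (ap t x)) \<and> (\<lambda>n. Re (\<mu> (R n))) \<longlonglongrightarrow> Re (\<mu> t)"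
  proof (rule increasing_limit[OF R])
    show "qf (R n) x \<le> qf (R (Suc n)) x" for n x
      by (rule LIMSEQ_le[OF lim_qf lim_qf]) (intro exI allI impI r_anti; simp)
  qed
  then obtain u where u: "u \<in> A" "star u = u" "\<And>x. qf u x \<le> (hnorm x)^2"
    "\<And>x. hlim (\<lambda>n. ap (R n) x) (ap u x)" "(\<lambda>n. Re (\<mu> (R n))) \<longlonglongrightarrow> Re (\<mu> u)" by blast
  \<comment> \<open>In the limit the bounds \<open>mu_r\<close> give
    \<open>\<mu>(u) \<ge> 1\<close>, while \<open>u \<le> 1\<close>; faithfulness, through
    \<open>mu_pos\<close>, leaves no gap.\<close>
  have "1 - u = 0"
  proof (rule mu_pos(2))
    have "1 - 2 * C * (1/2)^n \<le> Re (\<mu> (R n))" for n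
      using mu_r by (intro LIMSEQ_le_const[OF lim_r(2)]) auto
    moreover have "(\<lambda>n. 1 - 2 * C * (1/2::real)^n) \<longlonglongrightarrow> 1 - 2 * C * 0"
      by (intro tendsto_intros LIMSEQ_power_zero) auto
    ultimately have "1 - 2 * C * 0 \<le> Re (\<mu> u)" by (intro LIMSEQ_le[OF _ u(5)]) auto
    then show "Re (\<mu> (1 - u)) \<le> 0" using u(1) by (simp add: mu_simps)
  qed (use u in auto)
  then have "u = 1" by simp
  \<comment> \<open>At the vector \<open>r x\<close> the form of \<open>1 + s\<close> equals that of
    \<open>r\<close> at \<open>x\<close>, hence is at most the squared norm of \<open>x\<close>,
    regardless of the size of \<open>s\<close>. Since \<open>a \<le> e n \<le> s n m\<close> once
    \<open>m > n\<close>, the same bound holds for \<open>1 + a\<close>. Letting \<open>r x\<close>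
    tend to \<open>x\<close> then yields the claim.\<close>
  have "qf (1 + a) (ap (R n) x) \<le> (hnorm x)^2" for n
  proof (rule LIMSEQ_le_const2[OF tendsto_qf[OF lim_r(1)]], intro exI allI impI)
    fix m assume "m \<ge> Suc n"
    have "qf a y \<le> qf (s n m) y" for y
    proof -
      have "qf a y \<le> qf (s n (Suc n)) y" using e(4) by (simp add: qf_s)
      also have "\<dots> \<le> qf (s n m) y" using \<open>m \<ge> Suc n\<close> by (intro s_mono) auto
      finally show ?thesis .
    qed
    then have "qf (1 + a) (ap (r n m) x) \<le> qf (1 + s n m) (ap (r n m) x)" by simp
    also have "\<dots> = qf (r n m) x" using qf_resolvent[OF s(2,3)] by (simp only: r_def)
    also have "\<dots> \<le> (hnorm x)^2" by (rule r)
    finally show "qf (1 + a) (ap (r n m) x) \<le> (hnorm x)^2" .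
  qed
  then have "qf (1 + a) (ap u x) \<le> (hnorm x)^2" by (intro LIMSEQ_le_const2[OF tendsto_qf[OF u(4)]]) auto
  then show ?thesis by (simp add: \<open>u = 1\<close>)
qed

end

section \<open>Invariant functionals below the state\<close>

text \<open>An algebraic positive cone: *-automorphisms map squares to squares, and \<mu> is
  nonnegative on it by definition. Invariance of the operator order under an abstract automorphism
  would call for square roots.\<close>

inductive sos :: "'h::chilbert cop set \<Rightarrow> 'h cop \<Rightarrow> bool" for A where
  square: "t \<in> A \<Longrightarrow> sos A (star t * t)"
| add: "sos A s \<Longrightarrow> sos A t \<Longrightarrow> sos A (s + t)"

locale vn_system = vn_state A \<mu> for A :: "'h::chilbert cop set" and \<mu> +
  fixes \<Gamma> :: "('h cop \<Rightarrow> 'h cop) set"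
  assumes map_closed [simp]: "f \<in> \<Gamma> \<Longrightarrow> t \<in> A \<Longrightarrow> f t \<in> A"
    and map_add: "f \<in> \<Gamma> \<Longrightarrow> s \<in> A \<Longrightarrow> t \<in> A \<Longrightarrow> f (s + t) = f s + f t"
    and map_scC: "f \<in> \<Gamma> \<Longrightarrow> t \<in> A \<Longrightarrow> f (scC c t) = scC c (f t)"
    and map_mult: "f \<in> \<Gamma> \<Longrightarrow> s \<in> A \<Longrightarrow> t \<in> A \<Longrightarrow> f (s * t) = f s * f t"
    and map_star: "f \<in> \<Gamma> \<Longrightarrow> t \<in> A \<Longrightarrow> f (star t) = star (f t)"
    and map_one: "f \<in> \<Gamma> \<Longrightarrow> f 1 = 1"
    and mu_map: "f \<in> \<Gamma> \<Longrightarrow> t \<in> A \<Longrightarrow> \<mu> (f t) = \<mu> t"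
begin

lemma map_diff: "f \<in> \<Gamma> \<Longrightarrow> s \<in> A \<Longrightarrow> t \<in> A \<Longrightarrow> f (s - t) = f s - f t"
  using map_add[of f s "scC (-1) t"] map_scC[of f t "-1"] by (simp add: scC_simps)

lemma sos_props:
  assumes "sos A t"
  shows "t \<in> A" "star t = t" "0 \<le> qf t x" "0 \<le> Re (\<mu> t)"
  using assms by (induction) (auto simp: qf_square Re_mu_square mu_add)

lemma sos_scaleR:
  assumes "sos A t" "0 \<le> r" shows "sos A (r *\<^sub>R t)"
  using assms(1)
proof (induction)
  case (square t)
  have eq: "r *\<^sub>R (star t * t) = star (sqrt r *\<^sub>R t) * (sqrt r *\<^sub>R t)"
    using assms(2) by simp
  show ?case unfolding eq by (rule sos.square) (use square in simp)
next
  case (add s t)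
  then show ?case using sos.add by (simp add: scaleR_add_right)
qed

lemma sos_zero: "sos A 0"
  using sos.square[OF zero_closed] by simp

lemma sos_map: assumes "f \<in> \<Gamma>" "sos A t" shows "sos A (f t)"
  using assms(2)
proof (induction)
  case (square t)
  then show ?case using sos.square[of "f t" A] assms(1) by (simp add: map_mult map_star)
next
  case (add s t)
  then show ?case using sos.add[of A "f s" "f t"] sos_props(1) assms(1) by (simp add: map_add)
qed

section \<open>The optimisation problem\<close>

definition feasible :: "'h cop \<Rightarrow> 'h cop \<Rightarrow> 'h cop \<Rightarrow> bool" where
  "feasible a d c \<longleftrightarrow> d \<in> A \<and> star d = d \<and> sos A c \<and> sos A (c + d - a)"

text \<open>The factor 2 matches the derivative \<open>2 Re \<mu>(d u)\<close> of the quadratic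
  term, so that optimality in direction \<open>(u, v)\<close> reads
  \<open>0 \<le> \<psi> u + \<mu> v\<close>.\<close>

definition cost :: "'h cop \<Rightarrow> 'h cop \<Rightarrow> real" where
  "cost d c = Re (\<mu> (d * d)) + 2 * Re (\<mu> c)"

lemma Re_mu_herm_square: "d \<in> A \<Longrightarrow> star d = d \<Longrightarrow> 0 \<le> Re (\<mu> (d * d))"
  using Re_mu_square[of d] by simp

lemma cost_nonneg: "feasible a d c \<Longrightarrow> 0 \<le> cost d c"
  by (auto simp: feasible_def cost_def Re_mu_herm_square sos_props)

lemma feasible_midpoint:
  assumes "feasible a d c" "feasible a d' c'"
  shows "feasible a ((1/2) *\<^sub>R (d + d')) ((1/2) *\<^sub>R (c + c'))"
proof -
  have "(1/2) *\<^sub>R (c + c') + (1/2) *\<^sub>R (d + d') - a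
      = (1/2) *\<^sub>R (c + c') + (1/2) *\<^sub>R (d + d') - (1/2) *\<^sub>R (a + a)"
    by (simp only: scaleR_half_double)
  also have "\<dots> = (1/2) *\<^sub>R ((c + d - a) + (c' + d' - a))"
    by (simp only: scaleR_add_right scaleR_diff_right) simp
  finally show ?thesis using assms by (auto simp: feasible_def intro!: sos_scaleR sos.add)
qed

text \<open>Parallelogram law with the midpoint as competitor. The cost is quadratic in
  \<open>d\<close> but linear in \<open>c\<close>, so near-optimality forces only the
  \<open>d\<close> components together.\<close>

lemma feasible_near:
  assumes "feasible a d c" "feasible a d' c'" and F: "\<And>d c. feasible a d c \<Longrightarrow> F \<le> cost d c"
  shows "Re (\<mu> ((d - d') * (d - d'))) \<le> 2 * (cost d c - F) + 2 * (cost d' c' - F)"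
proof -
  have A: "d \<in> A" "d' \<in> A" "c \<in> A" "c' \<in> A" using assms(1,2) sos_props by (auto simp: feasible_def)
  have "(d - d') * (d - d') = 2 *\<^sub>R (d * d) + 2 *\<^sub>R (d' * d') - (d + d') * (d + d')"
    by (simp add: algebra_simps scaleR_2)
  then have "Re (\<mu> ((d - d') * (d - d')))
      = 2 * Re (\<mu> (d * d)) + 2 * Re (\<mu> (d' * d')) - Re (\<mu> ((d + d') * (d + d')))"
    using A by (simp add: mu_simps)
  moreover have "cost ((1/2) *\<^sub>R (d + d')) ((1/2) *\<^sub>R (c + c'))
      = (1/4) * Re (\<mu> ((d + d') * (d + d'))) + (Re (\<mu> c) + Re (\<mu> c'))"
  proof -
    have "((1/2) *\<^sub>R (d + d')) * ((1/2) *\<^sub>R (d + d')) = (1/4) *\<^sub>R ((d + d') * (d + d'))" by simp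
    then show ?thesis using A unfolding cost_def by (simp only: mu_scaleR add_closed mult_closed) (simp add: mu_add)
  qed
  moreover have "F \<le> cost ((1/2) *\<^sub>R (d + d')) ((1/2) *\<^sub>R (c + c'))"
    by (intro F feasible_midpoint assms)
  ultimately have "4 * F \<le> Re (\<mu> ((d + d') * (d + d'))) + 4 * Re (\<mu> c) + 4 * Re (\<mu> c')"
    and eq: "Re (\<mu> ((d - d') * (d - d')))
      = 2 * Re (\<mu> (d * d)) + 2 * Re (\<mu> (d' * d')) - Re (\<mu> ((d + d') * (d + d')))"
    by simp_all
  then show ?thesis unfolding cost_def eq by simp
qed

text \<open>Pairs of vanishing cost would yield positive elements above \<open>a\<close> with
  summable values, contradicting \<open>nonpos_of_dominated\<close>. The obstacle is that
  \<open>d\<close> need not be positive; it is absorbed by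
  \<open>d \<le> \<epsilon> + d^2 / \<epsilon>\<close>.\<close>

lemma cost_bounded_below:
  assumes a: "a \<in> A" "star a = a" and x: "0 < qf a x"
  shows "\<exists>\<delta>>0. \<forall>d c. feasible a d c \<longrightarrow> \<delta> \<le> cost d c"
proof (rule ccontr)
  assume "\<not> ?thesis"
  then have "\<exists>d c. feasible a d c \<and> cost d c < (1/4)^n" for n
    by (meson not_le zero_less_divide_1_iff zero_less_numeral zero_less_power)
  then obtain D E where DE: "\<And>n. feasible a (D n) (E n)" "\<And>n. cost (D n) (E n) < (1/4)^n" by metis
  \<comment> \<open>Here \<open>\<epsilon> = (1/2)^n\<close>. The cost bound \<open>(1/4)^n\<close>
    compensates the factor \<open>2^n\<close>, so each of the three summands has value at most
    \<open>(1/2)^n\<close>; hence the constant 3 below.\<close>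
  define e where "e n = E n + (1/2)^n *\<^sub>R 1 + 2^n *\<^sub>R (D n * D n)" for n
  have A: "D n \<in> A" "star (D n) = D n" "E n \<in> A" "star (E n) = E n" for n
    using DE(1)[of n] sos_props by (auto simp: feasible_def)
  have DD: "qf (D n * D n) x = (hnorm (ap (D n) x))^2" for n x using qf_square[of "D n" x] A by simp
  have D_le: "qf (D n) x \<le> (1/2)^n * (hnorm x)^2 + 2^n * (hnorm (ap (D n) x))^2" for n x
  proof -
    have "qf (D n) x \<le> hnorm x * hnorm (ap (D n) x)"
      using Re_cinner_le[of x "ap (D n) x"] by (simp add: qf_def abs_le_iff)
    also have "\<dots> = 2^n * (((1/2)^n * hnorm x) * hnorm (ap (D n) x))"
      by (simp add: power_one_over)
    also have "\<dots> \<le> 2^n * (((1/2)^n * hnorm x)^2 + (hnorm (ap (D n) x))^2)"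
    proof (intro mult_left_mono)
      have "p * q \<le> p^2 + q^2" for p q :: real
        using zero_le_power2[of "p - q"] zero_le_power2[of p] zero_le_power2[of q]
        unfolding power2_diff by linarith
      then show "((1/2)^n * hnorm x) * hnorm (ap (D n) x) \<le> ((1/2)^n * hnorm x)^2 + (hnorm (ap (D n) x))^2" .
    qed simp
    also have "\<dots> = (1/2)^n * (hnorm x)^2 + 2^n * (hnorm (ap (D n) x))^2"
      by (simp add: power_one_over power_mult_distrib power2_eq_square field_simps)
    finally show ?thesis .
  qed
  have "qf a x \<le> 0"
  proof (rule nonpos_of_dominated[OF a])
    fix n y
    show "e n \<in> A" "star (e n) = e n" using A by (auto simp: e_def)
    have "0 \<le> qf (E n) y" "0 \<le> qf (E n + D n - a) y"
      using DE(1)[of n] sos_props(3)[of "E n" y] sos_props(3)[of "E n + D n - a" y]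
      unfolding feasible_def by blast+
    then show "0 \<le> qf (e n) y" "qf a y \<le> qf (e n) y"
      using D_le[of n y] by (auto simp: e_def DD)
    have 1: "Re (\<mu> (D n * D n)) \<le> (1/4)^n" "Re (\<mu> (E n)) \<le> (1/4)^n"
      using DE(2)[of n] Re_mu_herm_square[OF A(1,2), of n] sos_props(4)[of "E n"] DE(1)[of n]
      by (auto simp: cost_def feasible_def)
    have "2^n * Re (\<mu> (D n * D n)) \<le> 2^n * (1/4)^n" using 1 by (intro mult_left_mono) auto
    also have "\<dots> = (1/2)^n" by (simp flip: power_mult_distrib)
    finally have 3: "2^n * Re (\<mu> (D n * D n)) \<le> (1/2)^n" .
    have 4: "(1/4::real)^n \<le> (1/2)^n" by (intro power_mono) auto
    have "Re (\<mu> (e n)) = Re (\<mu> (E n)) + (1/2)^n + 2^n * Re (\<mu> (D n * D n))"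
      using A by (simp add: e_def mu_simps flip: of_real_power)
    then show "Re (\<mu> (e n)) \<le> 3 * (1/2)^n" using 1 3 4 by linarith
  qed
  with x show False by simp
qed

text \<open>Cauchy-Schwarz controls the real part, the element \<open>\<i> z\<close> the imaginary
  part, and conjugation moves the hermitian \<open>H n\<close> to the other side.\<close>

lemma mu_tendsto_zero:
  assumes "\<And>n. H n \<in> A" "\<And>n. star (H n) = H n" "(\<lambda>n. Re (\<mu> (H n * H n))) \<longlonglongrightarrow> 0" "z \<in> A"
  shows "(\<lambda>n. \<mu> (H n * z)) \<longlonglongrightarrow> 0" "(\<lambda>n. \<mu> (z * H n)) \<longlonglongrightarrow> 0"
proof -
  have Re0: "(\<lambda>n. Re (\<mu> (H n * z))) \<longlonglongrightarrow> 0" if z: "z \<in> A" for z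
  proof -
    have "(\<lambda>n. (Re (\<mu> (H n * z)))^2) \<longlonglongrightarrow> 0"
    proof (rule Lim_null_comparison)
      show "\<forall>\<^sub>F n in sequentially. norm ((Re (\<mu> (H n * z)))^2) \<le> Re (\<mu> (H n * H n)) * Re (\<mu> (star z * z))"
        using mu_cauchy_schwarz[OF assms(1) z] assms(2) by (intro always_eventually) simp
      show "(\<lambda>n. Re (\<mu> (H n * H n)) * Re (\<mu> (star z * z))) \<longlonglongrightarrow> 0"
        using tendsto_mult_right[OF assms(3)] by simp
    qed
    then have "(\<lambda>n. sqrt ((Re (\<mu> (H n * z)))^2)) \<longlonglongrightarrow> sqrt 0" by (rule tendsto_real_sqrt)
    then show ?thesis by (simp add: tendsto_rabs_zero_iff)
  qed
  have 1: "(\<lambda>n. \<mu> (H n * z)) \<longlonglongrightarrow> 0" if z: "z \<in> A" for z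
  proof -
    have "Im (\<mu> (H n * z)) = - Re (\<mu> (H n * scC \<i> z))" for n
      using z assms(1) by (simp add: scC_simps mu_scC)
    then have "(\<lambda>n. Im (\<mu> (H n * z))) \<longlonglongrightarrow> 0"
      using tendsto_minus[OF Re0[of "scC \<i> z"]] z by simp
    with Re0[OF z] show ?thesis by (simp add: tendsto_complex_iff)
  qed
  then show "(\<lambda>n. \<mu> (H n * z)) \<longlonglongrightarrow> 0" using assms(4) .
  have "\<mu> (z * H n) = cnj (\<mu> (H n * star z))" for n
    using mu_star[of "H n * star z"] assms(1,2,4) by simp
  then show "(\<lambda>n. \<mu> (z * H n)) \<longlonglongrightarrow> 0"
    using tendsto_cnj[OF 1[of "star z"]] assms(4) by simp
qed

lemma mu_convergent:
  assumes D: "\<And>n. D n \<in> A" "\<And>n. star (D n) = D n"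
    and b: "\<And>m n. n \<le> m \<Longrightarrow> Re (\<mu> ((D m - D n) * (D m - D n))) \<le> b n" "b \<longlonglongrightarrow> 0"
    and "z \<in> A"
  shows "convergent (\<lambda>n. \<mu> (D n * z) + \<mu> (z * D n))"
proof -
  have Re_conv: "convergent (\<lambda>n. Re (\<mu> (D n * z)))" if z: "z \<in> A" for z
  proof (rule real_Cauchy_convergent, rule CauchyI')
    fix e :: real assume "e > 0"
    have "(\<lambda>n. b n * Re (\<mu> (star z * z))) \<longlonglongrightarrow> 0" using tendsto_mult_right[OF b(2)] by simp
    then have "\<forall>\<^sub>F n in sequentially. b n * Re (\<mu> (star z * z)) < e^2"
      using \<open>e > 0\<close> by (intro order_tendstoD(2)) auto
    then obtain N where N: "\<And>n. n \<ge> N \<Longrightarrow> b n * Re (\<mu> (star z * z)) < e^2"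
      by (auto simp: eventually_sequentially)
    show "\<exists>M. \<forall>m\<ge>M. \<forall>n>m. dist (Re (\<mu> (D m * z))) (Re (\<mu> (D n * z))) < e"
    proof (intro exI allI impI)
      fix m n assume mn: "m \<ge> N" "n > m"
      have "(Re (\<mu> (D n * z)) - Re (\<mu> (D m * z)))^2 = (Re (\<mu> (star (D n - D m) * z)))^2"
        using D z by (simp add: left_diff_distrib mu_diff)
      also have "\<dots> \<le> Re (\<mu> ((D n - D m) * (D n - D m))) * Re (\<mu> (star z * z))"
        using mu_cauchy_schwarz[of "D n - D m" z] D z by simp
      also have "\<dots> \<le> b m * Re (\<mu> (star z * z))"
        using mn b(1) z by (intro mult_right_mono Re_mu_square) auto
      also have "\<dots> < e^2" using mn N by simp
      finally have "\<bar>Re (\<mu> (D n * z)) - Re (\<mu> (D m * z))\<bar> < e"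
        using \<open>e > 0\<close> by (metis abs_of_pos power2_abs power2_less_imp_less abs_ge_zero)
      then show "dist (Re (\<mu> (D m * z))) (Re (\<mu> (D n * z))) < e" by (simp add: dist_real_def abs_minus_commute)
    qed
  qed
  have conv: "convergent (\<lambda>n. \<mu> (D n * z))" if z: "z \<in> A" for z
  proof -
    obtain p where p: "(\<lambda>n. Re (\<mu> (D n * z))) \<longlonglongrightarrow> p" using Re_conv[OF z] by (auto simp: convergent_def)
    obtain q where q: "(\<lambda>n. Re (\<mu> (D n * scC \<i> z))) \<longlonglongrightarrow> q"
      using Re_conv[of "scC \<i> z"] z by (auto simp: convergent_def)
    have "Im (\<mu> (D n * z)) = - Re (\<mu> (D n * scC \<i> z))" for n
      using z D by (simp add: scC_simps mu_scC)
    then have "(\<lambda>n. Im (\<mu> (D n * z))) \<longlonglongrightarrow> - q" using tendsto_minus[OF q] by simp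
    with p have "(\<lambda>n. \<mu> (D n * z)) \<longlonglongrightarrow> Complex p (- q)" by (simp add: tendsto_complex_iff)
    then show ?thesis by (auto simp: convergent_def)
  qed
  have "\<mu> (z * D n) = cnj (\<mu> (D n * star z))" for n
    using mu_star[of "D n * star z"] assms by simp
  moreover obtain l l' where "(\<lambda>n. \<mu> (D n * z)) \<longlonglongrightarrow> l" "(\<lambda>n. \<mu> (D n * star z)) \<longlonglongrightarrow> l'"
    using conv[of z] conv[of "star z"] \<open>z \<in> A\<close> by (auto simp: convergent_def)
  ultimately have "(\<lambda>n. \<mu> (D n * z) + \<mu> (z * D n)) \<longlonglongrightarrow> l + cnj l'"
    by (simp add: tendsto_add tendsto_cnj)
  then show ?thesis by (auto simp: convergent_def)
qed

text \<open>The functional is the derivative \<open>x \<mapsto> Re \<mu>(d x)\<close> of the cost at an optimal \<open>d\<close>, taken along a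
  minimising sequence, which is Cauchy in \<open>L\<^sup>2(\<mu>)\<close>. Optimality with respect to the perturbations
  \<open>(d + t x, c)\<close>, \<open>(d - t x, c + t x)\<close> and \<open>(d + t (a - d), c - t c)\<close> gives \<open>0 \<le> \<psi>\<close>, \<open>\<psi> \<le> \<mu>\<close> and
  \<open>\<psi> a > 0\<close>; uniqueness of the optimum gives invariance.\<close>

lemma invariant_functional_exists:
  assumes a: "a \<in> A" "star a = a" "\<forall>f\<in>\<Gamma>. f a = a" and x: "0 < qf a x"
  shows "\<exists>\<psi>. (\<forall>s\<in>A. \<forall>t\<in>A. \<psi> (s + t) = \<psi> s + \<psi> t) \<and> (\<forall>t\<in>A. \<forall>c. \<psi> (scC c t) = c * \<psi> t) \<and>
    (\<forall>t\<in>A. cpos (\<psi> (star t * t)) \<and> cpos (\<mu> (star t * t) - \<psi> (star t * t))) \<and>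
    (\<forall>f\<in>\<Gamma>. \<forall>t\<in>A. \<psi> (f t) = \<psi> t) \<and> 0 < Re (\<psi> a)"
proof -
  define V where "V = {cost d c | d c. feasible a d c}"
  define F where "F = Inf V"
  have feas_a: "feasible a a 0" using a sos_zero by (simp add: feasible_def)
  then have V: "V \<noteq> {}" by (auto simp: V_def)
  have bdd: "bdd_below V" using cost_nonneg by (auto simp: V_def intro!: bdd_belowI[of _ 0])
  have F_le: "F \<le> cost d c" if "feasible a d c" for d c
    unfolding F_def using that by (intro cInf_lower bdd) (auto simp: V_def)
  have F_pos: "0 < F"
  proof -
    obtain \<delta> where "\<delta> > 0" "\<And>d c. feasible a d c \<Longrightarrow> \<delta> \<le> cost d c"
      using cost_bounded_below[OF a(1,2) x] by blast
    then have "\<delta> \<le> F" unfolding F_def using V by (intro cInf_greatest) (auto simp: V_def)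
    with \<open>\<delta> > 0\<close> show ?thesis by simp
  qed
  have "\<exists>d c. feasible a d c \<and> cost d c < F + 1 / Suc n" for n
  proof -
    have "Inf V < F + 1 / Suc n" by (simp add: F_def)
    from cInf_lessD[OF V this] show ?thesis by (auto simp: V_def)
  qed
  then obtain D E where DE: "\<And>n. feasible a (D n) (E n)" "\<And>n. cost (D n) (E n) < F + 1 / Suc n" by metis
  have D: "D n \<in> A" "star (D n) = D n" and E: "sos A (E n)" "E n \<in> A" and DEa: "sos A (E n + D n - a)" for n
    using DE(1)[of n] sos_props by (auto simp: feasible_def)
  have inv0: "(\<lambda>n. 4 * (1 / real (Suc n))) \<longlonglongrightarrow> 0"
    using tendsto_mult_left[OF LIMSEQ_Suc[OF lim_1_over_n], of 4] by simp
  \<comment> \<open>Any competitor as good as the n-th pair qualifies. The later pairs of the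
    sequence give the Cauchy property, and the images under the action give invariance.\<close>
  have near: "Re (\<mu> ((d - D n) * (d - D n))) \<le> 4 * (1 / Suc n)"
    if "feasible a d c" "cost d c \<le> F + 1 / Suc n" for d c n
    using feasible_near[OF that(1) DE(1) F_le, of n] that(2) DE(2)[of n] by simp
  \<comment> \<open>Symmetrising makes \<psi> complex linear and real on hermitian elements, where
    it is the limit of \<open>Re (\<mu> (D n * z))\<close>.\<close>
  define \<psi> where "\<psi> z = lim (\<lambda>n. (\<mu> (D n * z) + \<mu> (z * D n)) / 2)" for z
  have psi: "(\<lambda>n. (\<mu> (D n * z) + \<mu> (z * D n)) / 2) \<longlonglongrightarrow> \<psi> z" if "z \<in> A" for z
  proof -
    have "Re (\<mu> ((D m - D n) * (D m - D n))) \<le> 4 * (1 / Suc n)" if "n \<le> m" for m n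
    proof (rule near[OF DE(1)])
      have "1 / Suc m \<le> 1 / real (Suc n)" using that by (simp add: frac_le)
      then show "cost (D m) (E m) \<le> F + 1 / Suc n" using DE(2)[of m] by linarith
    qed
    then have "convergent (\<lambda>n. \<mu> (D n * z) + \<mu> (z * D n))"
      using D inv0 that by (intro mu_convergent)
    then obtain l where "(\<lambda>n. \<mu> (D n * z) + \<mu> (z * D n)) \<longlonglongrightarrow> l" by (auto simp: convergent_def)
    then have "(\<lambda>n. (\<mu> (D n * z) + \<mu> (z * D n)) / 2) \<longlonglongrightarrow> l / 2" by (intro tendsto_divide tendsto_const) auto
    then show ?thesis unfolding \<psi>_def by (simp only: limI)
  qed
  have psi_eq: "\<psi> z = l" if "z \<in> A" "(\<lambda>n. (\<mu> (D n * z) + \<mu> (z * D n)) / 2) \<longlonglongrightarrow> l" for z l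
    using LIMSEQ_unique[OF psi] that by blast
  have psi_herm: "Im (\<psi> z) = 0" "(\<lambda>n. Re (\<mu> (D n * z))) \<longlonglongrightarrow> Re (\<psi> z)" if z: "z \<in> A" "star z = z" for z
  proof -
    have eq: "(\<mu> (D n * z) + \<mu> (z * D n)) / 2 = of_real (Re (\<mu> (D n * z)))" for n
      using mu_star[of "D n * z"] D[of n] z by (simp add: complex_eq_iff)
    have 1: "(\<lambda>n. complex_of_real (Re (\<mu> (D n * z)))) \<longlonglongrightarrow> \<psi> z" using psi[OF z(1)] unfolding eq .
    from tendsto_Im[OF 1] have "(\<lambda>n. 0::real) \<longlonglongrightarrow> Im (\<psi> z)" by simp
    then show "Im (\<psi> z) = 0" by (simp add: LIMSEQ_const_iff)
    from tendsto_Re[OF 1] show "(\<lambda>n. Re (\<mu> (D n * z))) \<longlonglongrightarrow> Re (\<psi> z)" by simp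
  qed
  have cost_perturb: "cost (d + t *\<^sub>R u) (c + t *\<^sub>R v)
      = cost d c + 2 * t * (Re (\<mu> (d * u)) + Re (\<mu> v)) + t^2 * Re (\<mu> (u * u))"
    if "d \<in> A" "star d = d" "c \<in> A" "u \<in> A" "star u = u" "v \<in> A" for d c u v t
  proof -
    have "(d + t *\<^sub>R u) * (d + t *\<^sub>R u) = d * d + t *\<^sub>R (d * u + u * d) + t^2 *\<^sub>R (u * u)"
      by (simp add: algebra_simps power2_eq_square)
    moreover have "\<mu> (u * d) = cnj (\<mu> (d * u))" using mu_star[of "d * u"] that by simp
    ultimately show ?thesis using that unfolding cost_def by (simp add: mu_simps flip: of_real_power) (simp add: algebra_simps)
  qed
  \<comment> \<open>First variation in direction \<open>(u, v)\<close>, with feasibility for all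
    positive \<open>t\<close> as hypothesis. The slack \<open>1 / Suc n\<close> disappears first, at
    fixed \<open>t\<close>; only then does \<open>t\<close> tend to 0.\<close>
  have optimal: "0 \<le> Re (\<psi> u) + Re (\<mu> v)"
    if uv: "u \<in> A" "star u = u" "v \<in> A" and
      sos: "\<And>n t. 0 < t \<Longrightarrow> sos A (E n + t *\<^sub>R v) \<and> sos A ((E n + D n - a) + t *\<^sub>R (u + v))" for u v
  proof (rule linear_coefficient_nonneg)
    fix t :: real assume t: "0 < t"
    have "0 \<le> 1 / Suc n + 2 * t * (Re (\<mu> (D n * u)) + Re (\<mu> v)) + t^2 * Re (\<mu> (u * u))" for n
    proof -
      have eq: "E n + t *\<^sub>R v + (D n + t *\<^sub>R u) - a = (E n + D n - a) + t *\<^sub>R (u + v)"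
        by (simp add: algebra_simps)
      have "feasible a (D n + t *\<^sub>R u) (E n + t *\<^sub>R v)"
        unfolding feasible_def eq using sos[OF t, of n] D uv by simp
      from F_le[OF this] DE(2)[of n] show ?thesis
        by (simp add: cost_perturb[OF D E(2) uv])
    qed
    moreover have "(\<lambda>n. 1 / Suc n + 2 * t * (Re (\<mu> (D n * u)) + Re (\<mu> v)) + t^2 * Re (\<mu> (u * u)))
        \<longlonglongrightarrow> 0 + 2 * t * (Re (\<psi> u) + Re (\<mu> v)) + t^2 * Re (\<mu> (u * u))"
      by (intro tendsto_intros LIMSEQ_Suc[OF lim_1_over_n] psi_herm uv)
    ultimately have "0 \<le> 0 + 2 * t * (Re (\<psi> u) + Re (\<mu> v)) + t^2 * Re (\<mu> (u * u))"
      by (intro LIMSEQ_le_const) auto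
    then show "0 \<le> t * (Re (\<psi> u) + Re (\<mu> v)) + t^2 * (Re (\<mu> (u * u)) / 2)" by simp
  qed
  have add: "\<psi> (s + t) = \<psi> s + \<psi> t" if "s \<in> A" "t \<in> A" for s t
  proof (rule psi_eq)
    have eq: "(\<mu> (D n * (s + t)) + \<mu> ((s + t) * D n)) / 2
        = (\<mu> (D n * s) + \<mu> (s * D n)) / 2 + (\<mu> (D n * t) + \<mu> (t * D n)) / 2" for n
      using that D by (simp add: distrib_left distrib_right mu_add add_divide_distrib)
    show "(\<lambda>n. (\<mu> (D n * (s + t)) + \<mu> ((s + t) * D n)) / 2) \<longlonglongrightarrow> \<psi> s + \<psi> t"
      unfolding eq by (intro tendsto_add psi that)
  qed (use that in simp)
  have scale: "\<psi> (scC c t) = c * \<psi> t" if "t \<in> A" for c t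
  proof (rule psi_eq)
    have eq: "(\<mu> (D n * scC c t) + \<mu> (scC c t * D n)) / 2 = c * ((\<mu> (D n * t) + \<mu> (t * D n)) / 2)" for n
      using that D by (simp add: scC_simps mu_scC algebra_simps)
    show "(\<lambda>n. (\<mu> (D n * scC c t) + \<mu> (scC c t * D n)) / 2) \<longlonglongrightarrow> c * \<psi> t"
      unfolding eq by (intro tendsto_mult_left psi that)
  qed (use that in simp)
  have minus: "\<psi> (- t) = - \<psi> t" if "t \<in> A" for t using scale[OF that, of "-1"] by (simp add: scC_simps)
  have pos: "cpos (\<psi> (star t * t)) \<and> cpos (\<mu> (star t * t) - \<psi> (star t * t))" if t: "t \<in> A" for t
  proof -
    let ?x = "star t * t"
    have x: "?x \<in> A" "star ?x = ?x" "sos A ?x" using t by (auto intro: sos.square)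
    have "0 \<le> Re (\<psi> ?x) + Re (\<mu> 0)"
      by (rule optimal) (use x E DEa in \<open>auto intro!: sos.add sos_scaleR\<close>)
    moreover have "0 \<le> Re (\<psi> (- ?x)) + Re (\<mu> ?x)"
      by (rule optimal) (use x E DEa in \<open>auto intro!: sos.add sos_scaleR\<close>)
    ultimately show ?thesis
      using psi_herm(1)[OF x(1,2)] mu_square[OF t] minus[OF x(1)] by (simp add: cpos_def mu_zero)
  qed
  have inv: "\<psi> (f t) = \<psi> t" if f: "f \<in> \<Gamma>" and t: "t \<in> A" for f t
  proof (rule psi_eq)
    define H where "H n = f (D n) - D n" for n
    have H: "H n \<in> A" "star (H n) = H n" for n :: nat
      using D f map_star[OF f D(1)[of n]] by (simp_all add: H_def)
    have "(\<lambda>n. Re (\<mu> (H n * H n))) \<longlonglongrightarrow> 0"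
    proof (rule Lim_null_comparison[OF _ inv0], intro always_eventually allI)
      fix n
      have eq: "f (E n) + f (D n) - a = f (E n + D n - a)"
        using f a(1) bspec[OF a(3) f] D E by (simp add: map_add map_diff)
      have "feasible a (f (D n)) (f (E n))"
        unfolding feasible_def eq using D(1)[of n] E DEa f sos_map map_star[OF f D(1)[of n]] D(2)[of n] by simp
      moreover have "cost (f (D n)) (f (E n)) = cost (D n) (E n)"
        using D E f by (simp add: cost_def mu_map flip: map_mult)
      ultimately have "Re (\<mu> (H n * H n)) \<le> 4 * (1 / Suc n)"
        unfolding H_def using DE(2)[of n] by (intro near) auto
      then show "norm (Re (\<mu> (H n * H n))) \<le> 4 * (1 / real (Suc n))"
        using Re_mu_herm_square[OF H, of n] by simp
    qed
    from mu_tendsto_zero[OF H this, of "f t"]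
    have lim: "(\<lambda>n. (\<mu> (D n * t) + \<mu> (t * D n)) / 2 - (\<mu> (H n * f t) + \<mu> (f t * H n)) / 2) \<longlonglongrightarrow> \<psi> t - (0 + 0) / 2"
      using f t by (intro tendsto_intros psi) auto
    \<comment> \<open>Replacing \<open>D n\<close> by \<open>f (D n)\<close> costs a term in
      \<open>H n\<close>, which is null; afterwards multiplicativity of \<open>f\<close> and
      invariance of \<mu> remove \<open>f\<close>.\<close>
    have eq: "(\<mu> (D n * f t) + \<mu> (f t * D n)) / 2
        = (\<mu> (D n * t) + \<mu> (t * D n)) / 2 - (\<mu> (H n * f t) + \<mu> (f t * H n)) / 2" for n
    proof -
      have "D n * f t = f (D n * t) - H n * f t" "f t * D n = f (t * D n) - f t * H n"
        using f t D by (auto simp: H_def map_mult algebra_simps)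
      then have "\<mu> (D n * f t) = \<mu> (D n * t) - \<mu> (H n * f t)" "\<mu> (f t * D n) = \<mu> (t * D n) - \<mu> (f t * H n)"
        using f t D H by (simp_all only: mu_diff mu_map map_closed mult_closed)
      then show ?thesis by (simp add: add_divide_distrib diff_divide_distrib)
    qed
    show "(\<lambda>n. (\<mu> (D n * f t) + \<mu> (f t * D n)) / 2) \<longlonglongrightarrow> \<psi> t"
      using lim unfolding eq by simp
  qed (use that in simp)
  have "0 \<le> 2 * (Re (\<psi> a) - F / 2)"
  proof (rule linear_coefficient_nonneg)
    fix t :: real assume t: "0 < t" "t \<le> 1"
    \<comment> \<open>Bounds the second-order coefficient uniformly in \<open>n\<close>, via
      \<open>(a - D)^2 \<le> 2 a^2 + 2 D^2\<close> and
      \<open>\<mu>(D^2) \<le> F + 1\<close>.\<close>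
    define K where "K = 2 * Re (\<mu> (a * a)) + 2 * (F + 1)"
    have "0 \<le> 1 / Suc n + 2 * t * (Re (\<mu> (D n * a)) - F / 2) + t^2 * K" for n
    proof -
      \<comment> \<open>The perturbed pair is the convex combination of \<open>(D n, E n)\<close>
        with the feasible pair \<open>(a, 0)\<close>.\<close>
      have eq: "(1 - t) *\<^sub>R E n + (D n + t *\<^sub>R (a - D n)) - a = (1 - t) *\<^sub>R (E n + D n - a)"
        by (simp add: algebra_simps)
      have "feasible a (D n + t *\<^sub>R (a - D n)) ((1 - t) *\<^sub>R E n)"
        unfolding feasible_def eq using D a t E DEa by (auto intro: sos_scaleR)
      moreover have "(1 - t) *\<^sub>R E n = E n + t *\<^sub>R (- E n)" by (simp add: algebra_simps)
      ultimately have "F \<le> cost (D n + t *\<^sub>R (a - D n)) (E n + t *\<^sub>R (- E n))"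
        using F_le by metis
      also have "\<dots> = cost (D n) (E n) + 2 * t * (Re (\<mu> (D n * (a - D n))) + Re (\<mu> (- E n)))
          + t^2 * Re (\<mu> ((a - D n) * (a - D n)))"
        by (rule cost_perturb) (use D E a in auto)
      finally have 1: "0 \<le> 1 / Suc n + 2 * t * (Re (\<mu> (D n * a)) - Re (\<mu> (D n * D n)) - Re (\<mu> (E n)))
          + t^2 * Re (\<mu> ((a - D n) * (a - D n)))"
        using DE(2)[of n] D E a by (simp add: right_diff_distrib mu_simps)
      \<comment> \<open>The derivative contains \<open>\<mu>(D^2) + \<mu>(E)\<close>, which is at
        least half of the cost \<open>\<mu>(D^2) + 2 \<mu>(E)\<close>.\<close>
      have "F / 2 \<le> Re (\<mu> (D n * D n)) + Re (\<mu> (E n))"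
        using F_le[OF DE(1)[of n]] Re_mu_herm_square[OF D, of n] by (simp add: cost_def)
      then have 2: "2 * t * (Re (\<mu> (D n * a)) - Re (\<mu> (D n * D n)) - Re (\<mu> (E n)))
          \<le> 2 * t * (Re (\<mu> (D n * a)) - F / 2)" using t by (intro mult_left_mono) auto
      have "(a - D n) * (a - D n) = 2 *\<^sub>R (a * a) + 2 *\<^sub>R (D n * D n) - (a + D n) * (a + D n)"
        by (simp add: algebra_simps scaleR_2)
      then have "Re (\<mu> ((a - D n) * (a - D n)))
          = 2 * Re (\<mu> (a * a)) + 2 * Re (\<mu> (D n * D n)) - Re (\<mu> ((a + D n) * (a + D n)))"
        using D a by (simp add: mu_diff mu_add mu_scaleR)
      moreover have "0 \<le> Re (\<mu> ((a + D n) * (a + D n)))" using D a by (intro Re_mu_herm_square) auto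
      moreover have "Re (\<mu> (D n * D n)) \<le> F + 1"
      proof -
        have "1 / real (Suc n) \<le> 1" by simp
        then show ?thesis using DE(2)[of n] sos_props(4)[OF E(1)[of n]] unfolding cost_def by linarith
      qed
      ultimately have "Re (\<mu> ((a - D n) * (a - D n))) \<le> K" by (simp add: K_def)
      then have "t^2 * Re (\<mu> ((a - D n) * (a - D n))) \<le> t^2 * K" by (intro mult_left_mono) auto
      with 1 2 show ?thesis by linarith
    qed
    moreover have "(\<lambda>n. 1 / Suc n + 2 * t * (Re (\<mu> (D n * a)) - F / 2) + t^2 * K)
        \<longlonglongrightarrow> 0 + 2 * t * (Re (\<psi> a) - F / 2) + t^2 * K"
      by (intro tendsto_intros LIMSEQ_Suc[OF lim_1_over_n] psi_herm a)
    ultimately have "0 \<le> 0 + 2 * t * (Re (\<psi> a) - F / 2) + t^2 * K"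
      by (intro LIMSEQ_le_const) auto
    then show "0 \<le> t * (2 * (Re (\<psi> a) - F / 2)) + t^2 * K" by (simp add: algebra_simps)
  qed
  then have "0 < Re (\<psi> a)" using F_pos by simp
  with add scale pos inv show ?thesis by blast
qed

text \<open>The real or the imaginary part of \<open>t\<close> is again fixed and not scalar;
  subtracting its mean gives \<open>a\<close>. If \<open>a \<le> 0\<close> held,
  \<open>\<mu> a = 0\<close> and faithfulness would make \<open>a\<close> vanish.\<close>

lemma centred_fixed_point:
  assumes t: "t \<in> A" "\<And>f. f \<in> \<Gamma> \<Longrightarrow> f t = t" "\<And>c. t \<noteq> scC c 1"
  shows "\<exists>a x. a \<in> A \<and> star a = a \<and> (\<forall>f\<in>\<Gamma>. f a = a) \<and> \<mu> a = 0 \<and> 0 < qf a x"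
proof -
  have fixed_star: "f (star t) = star t" if "f \<in> \<Gamma>" for f using map_star[OF that t(1)] t(2)[OF that] by simp
  have "\<exists>k. k \<in> A \<and> star k = k \<and> (\<forall>f\<in>\<Gamma>. f k = k) \<and> (\<forall>c. k \<noteq> scC c 1)"
  proof (rule ccontr)
    let ?u = "t + star t" and ?v = "scC \<i> (t - star t)"
    assume "\<not> ?thesis"
    then have scalar: "\<exists>c. k = scC c 1" if "k \<in> A" "star k = k" "\<And>f. f \<in> \<Gamma> \<Longrightarrow> f k = k" for k
      using that by blast
    have "\<exists>c. ?u = scC c 1"
    proof (rule scalar)
      show "f ?u = ?u" if "f \<in> \<Gamma>" for f
        using that t(1) fixed_star[OF that] t(2)[OF that] by (simp add: map_add)
    qed (use t(1) in \<open>simp_all add: add.commute\<close>)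
    moreover have "\<exists>c. ?v = scC c 1"
    proof (rule scalar)
      have "scC (- \<i>) (star t - t) = scC \<i> (t - star t)"
        by (rule cop_eqI) (simp add: cscale_minus_left cscale_diff_right)
      then show "star ?v = ?v" by simp
      show "f ?v = ?v" if "f \<in> \<Gamma>" for f
        using that t(1) fixed_star[OF that] t(2)[OF that] by (simp add: map_scC map_diff)
    qed (use t in simp)
    ultimately obtain c d where cd: "?u = scC c 1" "?v = scC d 1" by blast
    have one: "scC 1 r = r" for r :: "'h cop" by (rule cop_eqI) (simp add: cscale_one)
    \<comment> \<open>Recovers \<open>t\<close> as half of \<open>?u - \<i> ?v\<close>, a
      combination of two scalars.\<close>
    have "t = scC (1/2 + 1/2) t" by (simp add: one)
    also have "\<dots> = scC (1/2) (t + t)" by (simp only: scC_simps)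
    also have "t + t = ?u + scC (- \<i>) ?v" by (simp add: scC_simps one)
    also have "scC (1/2) \<dots> = scC (1/2 * (c + - \<i> * d)) 1" unfolding cd by (simp only: scC_simps distrib_left)
    finally show False using t(3) by blast
  qed
  then obtain k where k: "k \<in> A" "star k = k" "\<And>f. f \<in> \<Gamma> \<Longrightarrow> f k = k" "\<And>c. k \<noteq> scC c 1" by blast
  define a where "a = k - scC (\<mu> k) 1"
  have "cnj (\<mu> k) = \<mu> k" using mu_star[OF k(1)] k(2) by simp
  then have a: "a \<in> A" "star a = a" using k by (simp_all add: a_def)
  have mu_a: "\<mu> a = 0" using k by (simp add: a_def mu_simps)
  have "a \<noteq> 0" using k(4) by (simp add: a_def)
  have "\<exists>x. 0 < qf a x"
  proof (rule ccontr)
    assume "\<nexists>x. 0 < qf a x"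
    then have "- a = 0" using a mu_a by (intro mu_pos(2)) (auto simp: mu_minus not_less)
    with \<open>a \<noteq> 0\<close> show False by simp
  qed
  moreover have "f a = a" if "f \<in> \<Gamma>" for f
    using k(1) k(3)[OF that] that by (simp add: a_def map_diff map_scC map_one)
  ultimately show ?thesis using a mu_a by blast
qed

end

section \<open>Dynamical systems\<close>

lemma ap_ops:
  "ap 1 = id" "ap 0 = op_zero" "ap (s + t) = op_add (ap s) (ap t)" "ap (scC c t) = op_scale c (ap t)"
  "ap (s * t) = ap s \<circ> ap t" "ap (star t) = adj (ap t)"
  by (auto simp: fun_eq_iff op_zero_def op_add_def op_scale_def star.rep_eq)

lemma ap_Cop: "bop T \<Longrightarrow> ap (Cop T) = T"
  by (simp add: Cop_inverse)

lemma selfadj_ap: "selfadj (ap t) \<longleftrightarrow> star t = t"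
  by (simp add: selfadj_def bop_ap ap_inject flip: ap_ops)

lemma op_le_ap:
  assumes "star s = s" "star t = t"
  shows "op_le (ap s) (ap t) \<longleftrightarrow> (\<forall>x. qf s x \<le> qf t x)"
  using assms by (auto simp: op_le_def cpos_def qf_def Im_cinner_hermitian)

lemma commutant_ap:
  assumes "S \<subseteq> {T. bop T}"
  shows "ap u \<in> commutant S \<longleftrightarrow> (\<forall>t. ap t \<in> S \<longrightarrow> u * t = t * u)"
proof
  assume "ap u \<in> commutant S"
  then have "ap u \<circ> ap t = ap t \<circ> ap u" if "ap t \<in> S" for t using that by (auto simp: commutant_def)
  then show "\<forall>t. ap t \<in> S \<longrightarrow> u * t = t * u" by (simp add: ap_inject flip: ap_ops)
next
  assume *: "\<forall>t. ap t \<in> S \<longrightarrow> u * t = t * u"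
  show "ap u \<in> commutant S"
    unfolding commutant_def
  proof (intro CollectI conjI ballI)
    fix T assume "T \<in> S"
    then have T: "ap (Cop T) = T" using assms ap_Cop by blast
    with * \<open>T \<in> S\<close> have "u * Cop T = Cop T * u" by simp
    then have "ap (u * Cop T) = ap (Cop T * u)" by simp
    then show "ap u \<circ> T = T \<circ> ap u" unfolding ap_ops T .
  qed (rule bop_ap)
qed

lemma bicommutant_ap:
  assumes "S \<subseteq> {T. bop T}"
  shows "ap r \<in> commutant (commutant S) \<longleftrightarrow>
    (\<forall>u. (\<forall>t. ap t \<in> S \<longrightarrow> u * t = t * u) \<longrightarrow> u * r = r * u)"
proof -
  have "commutant S \<subseteq> {T. bop T}" by (auto simp: commutant_def)
  then show ?thesis unfolding commutant_ap[OF \<open>commutant S \<subseteq> _\<close>] commutant_ap[OF assms] by metis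
qed

text \<open>On the reals \<open>Sup\<close> is the least upper bound via \<open>LEAST\<close>, so
  all sets without upper bound share one default value. This matters because
  \<open>normal_state\<close> speaks of a \<open>SUP\<close> before monotonicity of the state is
  known to bound it.\<close>

lemma Sup_unbounded:
  fixes X Y :: "real set"
  assumes "\<not> bdd_above X" "\<not> bdd_above Y"
  shows "Sup X = Sup Y"
proof -
  have "(\<lambda>z. \<forall>x\<in>X. x \<le> z) = (\<lambda>z. False)" "(\<lambda>z. \<forall>x\<in>Y. x \<le> z) = (\<lambda>z. False)"
    using assms by (auto simp: bdd_above_def fun_eq_iff)
  then show ?thesis unfolding Sup_real_def by simp
qed

text \<open>Convergence of the quadratic forms makes the strong limit \<open>t\<close> the least
  upper bound of the sequence among all selfadjoint operators, as \<open>normal_state\<close>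
  requires.\<close>

lemma normal_state_SUP:
  assumes normal: "normal_state A \<phi>"
    and T: "\<And>n. ap (T n) \<in> A" "\<And>n. star (T n) = T n" "\<And>n x. 0 \<le> qf (T n) x"
      "\<And>n x. qf (T n) x \<le> qf (T (Suc n)) x"
    and t: "ap t \<in> A" "star t = t" "\<And>x. hlim (\<lambda>n. ap (T n) x) (ap t x)"
  shows "Re (\<phi> (ap t)) = (SUP n. Re (\<phi> (ap (T n))))"
proof -
  define D where "D = range (\<lambda>n. ap (T n))"
  have mono: "qf (T m) x \<le> qf (T n) x" if "m \<le> n" for m n x
    using lift_Suc_mono_le[of "\<lambda>n. qf (T n) x", OF T(4) that] .
  have lim: "(\<lambda>n. qf (T n) x) \<longlonglongrightarrow> qf t x" for x
    unfolding qf_def by (intro tendsto_Re hlim_cinner_right t)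
  have upper: "qf (T n) x \<le> qf t x" for n x
    using incseq_le[OF incseq_SucI lim] T(4) by blast
  have "Re (\<phi> (ap t)) = (SUP T\<in>D. Re (\<phi> T))"
  proof (rule normal[unfolded normal_state_def, rule_format], intro conjI ballI allI impI)
    show "D \<subseteq> A" using T(1) by (auto simp: D_def)
    show "D \<noteq> {}" by (simp add: D_def)
    show "selfadj U" if "U \<in> D" for U using that T(2) by (auto simp: D_def selfadj_ap)
    show "op_le op_zero U" if "U \<in> D" for U
      using that T(2,3) by (auto simp: D_def op_le_ap simp flip: ap_ops(2))
    show "\<exists>W\<in>D. op_le U W \<and> op_le V W" if UV: "U \<in> D" "V \<in> D" for U V
    proof -
      obtain m n where "U = ap (T m)" "V = ap (T n)" using UV by (auto simp: D_def)
      then have "op_le U (ap (T (max m n))) \<and> op_le V (ap (T (max m n)))"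
        using T(2) mono by (simp add: op_le_ap)
      then show ?thesis by (auto simp: D_def)
    qed
    show "op_le U (ap t)" if "U \<in> D" for U using that T(2) t(2) upper by (auto simp: D_def op_le_ap)
    show "op_le (ap t) U" if U: "selfadj U \<and> (\<forall>T\<in>D. op_le T U)" for U
    proof -
      have apU: "ap (Cop U) = U" using U by (simp add: selfadj_def ap_Cop)
      with U have star: "star (Cop U) = Cop U" by (metis selfadj_ap)
      have "qf (T n) x \<le> qf (Cop U) x" for n x
      proof -
        have "op_le (ap (T n)) (ap (Cop U))" using U unfolding apU by (simp add: D_def)
        then show ?thesis using T(2) star by (simp add: op_le_ap)
      qed
      then have "qf t x \<le> qf (Cop U) x" for x by (intro LIMSEQ_le_const2[OF lim]) auto
      then have "op_le (ap t) (ap (Cop U))" using t(2) star by (simp add: op_le_ap)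
      then show ?thesis unfolding apU .
    qed
  qed (use t in \<open>simp_all add: selfadj_ap\<close>)
  then show ?thesis by (simp add: D_def image_image)
qed

text \<open>Unitality comes from surjectivity: with \<open>f T = id\<close>, multiplicativity gives
  \<open>id = f (id \<circ> T) = f id \<circ> id\<close>.\<close>

lemma automorphism_id:
  assumes "star_automorphism A f" "id \<in> A"
  shows "f id = id"
proof -
  obtain T where T: "T \<in> A" "f T = id"
    using assms unfolding star_automorphism_def bij_betw_def by (metis imageE)
  have "f (id \<circ> T) = f id \<circ> f T" using assms T(1) unfolding star_automorphism_def by blast
  then show ?thesis using T(2) by simp
qed

text \<open>Closure under sums, products and scalars is read off from the bicommutant equation:
  whatever commutes with the constituents commutes with the combination.\<close>

lemma dynamical_system_vn_system:
  fixes A :: "('h::chilbert \<Rightarrow> 'h) set"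
  assumes sys: "dynamical_system G A \<mu> \<alpha>"
  shows "vn_system {t. ap t \<in> A} (\<lambda>t. \<mu> (ap t)) ((\<lambda>g t. Cop (\<alpha> g (ap t))) ` carrier G)"
proof -
  note sys' = sys[unfolded dynamical_system_def von_neumann_algebra_def]
  have sub: "A \<subseteq> {T. bop T}" and adj_A: "\<And>T. T \<in> A \<Longrightarrow> adj T \<in> A" and bicomm: "commutant (commutant A) = A"
    and state: "is_state A \<mu>" and faithful: "faithful_state A \<mu>" and normal: "normal_state A \<mu>"
    and aut: "\<And>g. g \<in> carrier G \<Longrightarrow> star_automorphism A (\<alpha> g)"
    and invar: "\<And>g T. g \<in> carrier G \<Longrightarrow> T \<in> A \<Longrightarrow> \<mu> (\<alpha> g T) = \<mu> T"
    using sys' by blast+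
  have memI: "ap r \<in> A" if "\<And>u. (\<And>t. ap t \<in> A \<Longrightarrow> u * t = t * u) \<Longrightarrow> u * r = r * u" for r
    using bicommutant_ap[OF sub, of r] that unfolding bicomm by blast
  have one: "ap 1 \<in> A" by (rule memI) simp
  have add: "ap (s + t) \<in> A" if "ap s \<in> A" "ap t \<in> A" for s t
    by (rule memI) (use that in \<open>simp add: distrib_left distrib_right\<close>)
  have mult: "ap (s * t) \<in> A" if "ap s \<in> A" "ap t \<in> A" for s t
  proof (rule memI)
    fix u assume u: "\<And>t. ap t \<in> A \<Longrightarrow> u * t = t * u"
    have "u * (s * t) = (u * s) * t" by (simp only: mult.assoc)
    also have "\<dots> = s * (u * t)" using u[OF that(1)] by (simp add: mult.assoc)
    also have "\<dots> = s * t * u" using u[OF that(2)] by (simp add: mult.assoc)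
    finally show "u * (s * t) = s * t * u" .
  qed
  have scale: "ap (scC c t) \<in> A" if "ap t \<in> A" for c t
    by (rule memI) (use that in \<open>simp add: scC_simps\<close>)
  have star: "ap (star t) \<in> A" if "ap t \<in> A" for t using adj_A[OF that] by (simp add: ap_ops)
  have \<mu>_add: "\<mu> (ap (s + t)) = \<mu> (ap s) + \<mu> (ap t)" if "ap s \<in> A" "ap t \<in> A" for s t
    using state that by (simp add: is_state_def ap_ops)
  have \<mu>_one: "\<mu> (ap 1) = 1" using state by (simp add: is_state_def ap_ops)
  show ?thesis
  proof
    fix T :: "nat \<Rightarrow> 'h cop" and t
    assume T: "\<And>n. T n \<in> {t. ap t \<in> A}" "\<And>n. star (T n) = T n" "\<And>n x. 0 \<le> qf (T n) x"
        "\<And>n x. qf (T n) x \<le> qf (T (Suc n)) x"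
      and t: "t \<in> {t. ap t \<in> A}" "star t = t" "\<And>x. hlim (\<lambda>n. ap (T n) x) (ap t x)"
      and inc: "incseq (\<lambda>n. Re (\<mu> (ap (T n))))"
    have SUP: "Re (\<mu> (ap t)) = (SUP n. Re (\<mu> (ap (T n))))"
      by (rule normal_state_SUP[OF normal]) (use T t in auto)
    have "bdd_above (range (\<lambda>n. Re (\<mu> (ap (T n)))))"
    proof (rule ccontr)
      \<comment> \<open>The supremum of an unbounded set is an unspecified constant; compare \<open>T n\<close> with \<open>T n + 1\<close>.\<close>
      assume unbdd: "\<not> ?thesis"
      have \<mu>_Suc: "Re (\<mu> (ap (T n + 1))) = Re (\<mu> (ap (T n))) + 1" for n
        using T(1) one by (simp add: \<mu>_add \<mu>_one)
      have "Re (\<mu> (ap (t + 1))) = (SUP n. Re (\<mu> (ap (T n + 1))))"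
      proof (rule normal_state_SUP[OF normal])
        show "hlim (\<lambda>n. ap (T n + 1) x) (ap (t + 1) x)" for x using t(3)[of x] by (simp add: hlim_def)
      qed (use T t one add in auto)
      also have "\<dots> = (SUP n. Re (\<mu> (ap (T n))))"
      proof (rule Sup_unbounded[OF _ unbdd], rule notI)
        assume "bdd_above (range (\<lambda>n. Re (\<mu> (ap (T n + 1)))))"
        then obtain M where "\<And>n. Re (\<mu> (ap (T n))) + 1 \<le> M" by (auto simp: bdd_above_def \<mu>_Suc)
        then have "bdd_above (range (\<lambda>n. Re (\<mu> (ap (T n)))))"
          by (intro bdd_aboveI2[of _ _ M]) (smt (verit))
        with unbdd show False ..
      qed
      also have "\<dots> = Re (\<mu> (ap t))" by (rule SUP[symmetric])
      finally show False using t(1) one by (simp add: \<mu>_add \<mu>_one)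
    qed
    from LIMSEQ_incseq_SUP[OF this inc] show "(\<lambda>n. Re (\<mu> (ap (T n)))) \<longlonglongrightarrow> Re (\<mu> (ap t))"
      unfolding SUP .
  next
    fix r
    assume "\<And>u. (\<And>t. t \<in> {t. ap t \<in> A} \<Longrightarrow> u * t = t * u) \<Longrightarrow> u * r = r * u"
    then show "r \<in> {t. ap t \<in> A}" using memI[of r] by simp
  next
    fix t assume t: "t \<in> {t. ap t \<in> A}"
    show "cpos (\<mu> (ap (star t * t)))" using state t by (simp add: is_state_def ap_ops)
    show "\<mu> (ap (scC c t)) = c * \<mu> (ap t)" for c using state t by (simp add: is_state_def ap_ops)
    show "t = 0" if "\<mu> (ap (star t * t)) = 0"
    proof -
      have "ap t = op_zero" using faithful t that by (simp add: faithful_state_def ap_ops)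
      then show ?thesis by (metis ap_inject ap_ops(2))
    qed
  next
    fix f assume "f \<in> (\<lambda>g t. Cop (\<alpha> g (ap t))) ` carrier G"
    then obtain g where g: "g \<in> carrier G" and f: "f = (\<lambda>t. Cop (\<alpha> g (ap t)))" by blast
    have \<alpha>_A: "\<alpha> g T \<in> A" if "T \<in> A" for T
      using aut[OF g] that by (auto simp: star_automorphism_def bij_betw_def)
    have ap_f: "ap (f t) = \<alpha> g (ap t)" if "ap t \<in> A" for t
      using \<alpha>_A[OF that] sub ap_Cop by (auto simp: f)
    note aut_g = aut[OF g, unfolded star_automorphism_def]
    {
      fix t assume t: "t \<in> {t. ap t \<in> A}"
      show "f t \<in> {t. ap t \<in> A}" using t \<alpha>_A by (simp add: ap_f)
      show "f (scC c t) = scC c (f t)" for c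
      proof -
        have "ap (f (scC c t)) = ap (scC c (f t))"
          using t aut_g scale[of t c] by (simp add: ap_f ap_ops(4))
        then show ?thesis by (simp add: ap_inject)
      qed
      show "f (star t) = star (f t)"
      proof -
        have "ap (f (star t)) = ap (star (f t))"
          using t aut_g star[of t] by (simp add: ap_f ap_ops(6))
        then show ?thesis by (simp add: ap_inject)
      qed
      show "\<mu> (ap (f t)) = \<mu> (ap t)" using t invar g by (simp add: ap_f)
    next
      fix s t assume st: "s \<in> {t. ap t \<in> A}" "t \<in> {t. ap t \<in> A}"
      show "f (s + t) = f s + f t"
      proof -
        have "ap (f (s + t)) = ap (f s + f t)"
          using st aut_g add[of s t] by (simp add: ap_f ap_ops(3))
        then show ?thesis by (simp add: ap_inject)
      qed
      show "f (s * t) = f s * f t"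
      proof -
        have "ap (f (s * t)) = ap (f s * f t)"
          using st aut_g mult[of s t] by (simp add: ap_f ap_ops(5))
        then show ?thesis by (simp add: ap_inject)
      qed
    next
      have "ap (f 1) = ap 1" using automorphism_id[OF aut[OF g]] one by (simp add: ap_f ap_ops(1))
      then show "f 1 = 1" by (simp add: ap_inject)
    }
  qed (use one add mult scale star \<mu>_add \<mu>_one in \<open>auto simp flip: ap_ops\<close>)
qed

section \<open>Two-dimensional identity systems\<close>

lemma scC_diff: "scC (c - d) t = scC c t - scC d t" "scC c (s - t) = scC c s - scC c t"
  using scC_simps(4)[of "c - d" d t] scC_simps(3)[of c "s - t" t] by (simp_all add: algebra_simps)

lemma scC_zero: "scC 0 t = 0" "scC 1 t = t"
  by (rule cop_eqI, simp add: cscale_one)+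

lift_definition rank_one :: "'h::chilbert \<Rightarrow> 'h \<Rightarrow> 'h cop" is "\<lambda>x y z. cscale (cinner y z) x"
proof (rule bopI)
  fix x y z :: 'h
  have "hnorm (cscale (cinner y z) x) \<le> (2 * (hnorm y * hnorm z)) * hnorm x"
    unfolding hnorm_cscale by (intro mult_right_mono cmod_cinner_le hnorm_nonneg)
  then show "hnorm (cscale (cinner y z) x) \<le> (2 * hnorm y * hnorm x) * hnorm z" by (simp add: mult_ac)
qed (simp_all add: cinner_simps cscale_add_left cscale_cscale)

lemma ap_rank_one [simp]: "ap (rank_one x y) z = cscale (cinner y z) x"
  by transfer simp

lemma star_rank_one: "star (rank_one x y) = rank_one y x"
proof (rule star_eqI)
  fix u v
  have "cnj (cinner y u) = cinner u y" by (rule cinner_cnj[symmetric])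
  then show "cinner (ap (rank_one x y) u) v = cinner u (ap (rank_one y x) v)"
    by (simp add: cinner_simps)
qed

text \<open>A two-point probability space with masses \<open>wt\<close> and \<open>1 - wt\<close>,
  realised as operators on \<open>'h\<close>. Strict inequalities for \<open>wt\<close> make the
  state faithful.\<close>

locale two_point =
  fixes e f :: "'h::chilbert" and wt :: real
  assumes ee: "cinner e e = 1" and ff: "cinner f f = 1" and ef: "cinner e f = 0"
    and wt: "0 < wt" "wt < 1"
begin

definition p :: "'h cop" where "p = rank_one e e"

text \<open>Acts as \<open>c\<close> on the line of \<open>e\<close> and as \<open>d\<close> on its
  whole orthogonal complement; \<open>f\<close> is merely a unit vector there that reads off
  \<open>d\<close>.\<close>

definition diag :: "complex \<Rightarrow> complex \<Rightarrow> 'h cop" where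
  "diag c d = scC (c - d) p + scC d 1"

definition B :: "('h \<Rightarrow> 'h) set" where "B = {ap (diag c d) | c d. True}"

definition \<nu> :: "('h \<Rightarrow> 'h) \<Rightarrow> complex" where
  "\<nu> T = wt * cinner e (T e) + (1 - wt) * cinner f (T f)"

lemma fe: "cinner f e = 0"
  using cinner_cnj[of f e] ef by simp

lemma p_p: "p * p = p"
  by (rule cop_eqI) (simp add: p_def cinner_simps ee cscale_one)

lemma star_p: "star p = p"
  by (simp add: p_def star_rank_one)

lemma diag_simps:
  "diag c d + diag c' d' = diag (c + c') (d + d')" "scC k (diag c d) = diag (k * c) (k * d)"
  "diag c d * diag c' d' = diag (c * c') (d * d')" "star (diag c d) = diag (cnj c) (cnj d)"
  "diag 1 1 = 1" "diag 0 0 = 0"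
  by (simp_all add: diag_def scC_simps scC_diff scC_zero algebra_simps p_p star_p)

lemma diag_e: "ap (diag c d) e = cscale c e"
  by (simp add: diag_def p_def ee cscale_one flip: cscale_add_left)

lemma diag_f: "ap (diag c d) f = cscale d f"
  by (simp add: diag_def p_def ef)

lemma diag_eq: "diag c d = diag c' d' \<longleftrightarrow> c = c' \<and> d = d'"
proof
  assume "diag c d = diag c' d'"
  then have "cinner e (ap (diag c d) e) = cinner e (ap (diag c' d') e)"
    "cinner f (ap (diag c d) f) = cinner f (ap (diag c' d') f)" by simp_all
  then show "c = c' \<and> d = d'" by (simp add: diag_e diag_f cinner_simps ee ff)
qed simp

lemma nu_diag: "\<nu> (ap (diag c d)) = wt * c + (1 - wt) * d" for c d :: complex
  by (simp add: \<nu>_def diag_e diag_f cinner_simps ee ff)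

lemma qf_diag:
  "qf (diag c d) x = Re c * (cmod (cinner e x))^2 + Re d * ((hnorm x)^2 - (cmod (cinner e x))^2)"
proof -
  have "cinner x e = cnj (cinner e x)" by (rule cinner_cnj)
  then have "cinner x (ap p x) = of_real ((cmod (cinner e x))^2)"
    by (simp only: p_def ap_rank_one cinner_scale_right complex_norm_square)
  then have eq: "cinner x (ap (diag c d) x) = (c - d) * of_real ((cmod (cinner e x))^2) + d * of_real ((hnorm x)^2)"
    by (simp add: diag_def cinner_simps cinner_self)
  show ?thesis
    unfolding qf_def eq by (simp add: algebra_simps del: of_real_power)
qed

lemma bessel: "(cmod (cinner e x))^2 \<le> (hnorm x)^2"
proof -
  have "diag 0 1 = star (diag 0 1) * diag 0 1" by (simp add: diag_simps)
  then have "0 \<le> qf (diag 0 1) x" using qf_square[of "diag 0 1" x] by simp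
  then show ?thesis by (simp add: qf_diag)
qed

lemma qf_diag_le:
  "(\<forall>x. qf (diag c d) x \<le> qf (diag c' d') x) \<longleftrightarrow> Re c \<le> Re c' \<and> Re d \<le> Re d'"
proof
  assume *: "\<forall>x. qf (diag c d) x \<le> qf (diag c' d') x"
  from *[rule_format, of e] *[rule_format, of f] show "Re c \<le> Re c' \<and> Re d \<le> Re d'"
    by (simp add: qf_diag hnorm_sq ee ff ef)
next
  assume "Re c \<le> Re c' \<and> Re d \<le> Re d'"
  then show "\<forall>x. qf (diag c d) x \<le> qf (diag c' d') x"
    unfolding qf_diag using bessel by (auto intro!: add_mono mult_right_mono)
qed

lemma star_diag: "star (diag c d) = diag c d \<longleftrightarrow> Im c = 0 \<and> Im d = 0"
  by (auto simp: diag_simps diag_eq complex_eq_iff)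

lemma op_le_diag:
  assumes "selfadj (ap (diag c d))" "selfadj (ap (diag c' d'))"
  shows "op_le (ap (diag c d)) (ap (diag c' d')) \<longleftrightarrow> Re c \<le> Re c' \<and> Re d \<le> Re d'"
  using assms by (simp add: op_le_ap selfadj_ap qf_diag_le)

lemma vna_B: "von_neumann_algebra B"
  unfolding von_neumann_algebra_def
proof (intro conjI ballI)
  show sub: "B \<subseteq> {T. bop T}" by (auto simp: B_def bop_ap)
  show "adj T \<in> B" if "T \<in> B" for T
  proof -
    obtain c d where "T = ap (diag c d)" using \<open>T \<in> B\<close> by (auto simp: B_def)
    then have "adj T = ap (diag (cnj c) (cnj d))" by (simp add: diag_simps flip: ap_ops)
    then show ?thesis by (auto simp: B_def)
  qed
  have comm: "u * diag c d = diag c d * u" if "u * p = p * u" for u c d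
    using that by (simp add: diag_def scC_simps distrib_left distrib_right)
  show "commutant (commutant B) = B"
  proof (intro equalityI subsetI)
    fix T assume T: "T \<in> B"
    then obtain c d where cd: "T = ap (diag c d)" by (auto simp: B_def)
    show "T \<in> commutant (commutant B)"
      unfolding cd bicommutant_ap[OF sub] using T cd by blast
  next
    fix T assume T: "T \<in> commutant (commutant B)"
    then have "bop T" by (simp add: commutant_def)
    define r where "r = Cop T"
    have ap_r: "ap r = T" using \<open>bop T\<close> by (simp add: r_def ap_Cop)
    have r: "u * r = r * u" if u: "u * p = p * u" for u
    proof -
      have "ap r \<in> commutant (commutant B)" using T ap_r by simp
      moreover have "u * t = t * u" if "ap t \<in> B" for t
        using that comm[OF u] by (auto simp: B_def ap_inject)
      ultimately show ?thesis unfolding bicommutant_ap[OF sub] by blast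
    qed
    \<comment> \<open>Commuting with \<open>p\<close> makes \<open>e\<close> an eigenvector of
      \<open>r\<close>.\<close>
    have "ap (p * r) e = ap (r * p) e" using r[of p] by simp
    then have r_e: "ap r e = cscale (cinner e (ap r e)) e" by (simp add: p_def ee cscale_one)
    have r_perp: "ap r (x - ap p x) = cscale (cinner f (ap r f)) (x - ap p x)" for x
    proof -
      \<comment> \<open>This \<open>u\<close> sends \<open>f\<close> to the part of \<open>x\<close>
        orthogonal to \<open>e\<close> and commutes with \<open>p\<close> because both products
        vanish. Commutation with \<open>r\<close> thus copies the value of \<open>r\<close> at
        \<open>f\<close> to the entire complement.\<close>
      define u where "u = (1 - p) * rank_one x f"
      have "p * u = 0" by (simp add: u_def mult.assoc[symmetric] algebra_simps p_p)
      moreover have "u * p = 0" by (rule cop_eqI) (simp add: u_def p_def cinner_simps fe)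
      ultimately have "ap (u * r) f = ap (r * u) f" using r[of u] by simp
      then show ?thesis by (simp add: u_def ff cscale_one)
    qed
    have "r = diag (cinner e (ap r e)) (cinner f (ap r f))"
    proof (rule cop_eqI)
      fix x
      have "ap r x = ap r (ap p x) + ap r (x - ap p x)" by simp
      also have "ap r (ap p x) = cscale (cinner e (ap r e)) (ap p x)"
        using r_e by (simp add: p_def cscale_cscale) (metis cscale_cscale mult.commute)
      also have "\<dots> + ap r (x - ap p x) = ap (diag (cinner e (ap r e)) (cinner f (ap r f))) x"
        unfolding r_perp by (simp add: diag_def scC_diff cscale_diff_right)
      finally show "ap r x = ap (diag (cinner e (ap r e)) (cinner f (ap r f))) x" .
    qed
    then have "ap r = ap (diag (cinner e (ap r e)) (cinner f (ap r f)))" by (rule arg_cong)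
    then show "T \<in> B" unfolding ap_r B_def by blast
  qed
qed

lemma sigma_finite_B: "sigma_finite_vna B"
  unfolding sigma_finite_vna_def
proof (intro allI impI)
  fix F assume F: "F \<subseteq> B \<and> (\<forall>P\<in>F. is_projection P \<and> P \<noteq> op_zero) \<and> (\<forall>P\<in>F. \<forall>Q\<in>F. P \<noteq> Q \<longrightarrow> P \<circ> Q = op_zero)"
  \<comment> \<open>Idempotence alone forces both coefficients into \<open>{0, 1}\<close>, so there
    are at most four candidates.\<close>
  have "F \<subseteq> (\<lambda>(c, d). ap (diag c d)) ` ({0, 1} \<times> {0, 1})"
  proof
    fix P assume P: "P \<in> F"
    with F obtain c d where cd: "P = ap (diag c d)" by (auto simp: B_def)
    have "P \<circ> P = P" using F P by (simp add: is_projection_def)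
    then have "diag c d * diag c d = diag c d" unfolding cd by (simp add: ap_inject flip: ap_ops)
    then have "c * c = c \<and> d * d = d" by (simp add: diag_simps diag_eq)
    then have "c \<in> {0, 1} \<and> d \<in> {0, 1}" by auto
    then show "P \<in> (\<lambda>(c, d). ap (diag c d)) ` ({0, 1} \<times> {0, 1})"
      unfolding cd by (intro image_eqI[of _ _ "(c, d)"]) auto
  qed
  then show "countable F" by (rule countable_subset) (auto intro: countable_finite)
qed

lemma state_B: "is_state B \<nu>" "faithful_state B \<nu>"
proof -
  have sq: "\<nu> (adj (ap (diag c d)) \<circ> ap (diag c d)) = of_real (wt * (cmod c)^2 + (1 - wt) * (cmod d)^2)" for c d
  proof -
    have norm: "cnj z * z = of_real ((cmod z)^2)" for z
      by (simp only: complex_norm_square mult.commute)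
    have "\<nu> (ap (star (diag c d) * diag c d)) = wt * (cnj c * c) + (1 - wt) * (cnj d * d)"
      by (simp only: diag_simps nu_diag)
    then show ?thesis unfolding norm ap_ops by simp
  qed
  show "is_state B \<nu>"
    unfolding is_state_def
  proof (intro conjI ballI allI)
    show "\<nu> (op_add T S) = \<nu> T + \<nu> S" for T S
      by (simp add: \<nu>_def op_add_def cinner_simps algebra_simps)
    show "\<nu> (op_scale c T) = c * \<nu> T" for T c
      by (simp add: \<nu>_def op_scale_def cinner_simps algebra_simps)
    show "cpos (\<nu> (adj T \<circ> T))" if "T \<in> B" for T
      using that wt unfolding B_def by (auto simp: sq cpos_def)
    show "\<nu> id = 1" by (simp add: \<nu>_def ee ff)
  qed
  show "faithful_state B \<nu>"
    unfolding faithful_state_def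
  proof (intro ballI impI)
    fix T assume "T \<in> B" and 0: "\<nu> (adj T \<circ> T) = 0"
    then obtain c d where cd: "T = ap (diag c d)" by (auto simp: B_def)
    have "wt * (cmod c)^2 + (1 - wt) * (cmod d)^2 = 0" using 0 unfolding cd sq of_real_eq_0_iff .
    then have "c = 0 \<and> d = 0" using wt by (simp add: add_nonneg_eq_0_iff)
    then show "T = op_zero" unfolding cd by (simp add: diag_simps ap_ops)
  qed
qed

text \<open>The order on \<open>B\<close> is coordinatewise. The pair of coordinate suprema is an
  upper bound, hence dominates the least one, \<open>S\<close>; directedness then supplies a single
  element close to both suprema.\<close>

lemma normal_B: "normal_state B \<nu>"
  unfolding normal_state_def
proof (intro allI impI, elim conjE)
  fix D S
  assume DB: "D \<subseteq> B" and "D \<noteq> {}" and D: "\<forall>T\<in>D. selfadj T \<and> op_le op_zero T"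
    and dir: "\<forall>T\<in>D. \<forall>U\<in>D. \<exists>V\<in>D. op_le T V \<and> op_le U V"
    and S: "S \<in> B" "selfadj S" "\<forall>T\<in>D. op_le T S"
    and least: "\<forall>U. selfadj U \<and> (\<forall>T\<in>D. op_le T U) \<longrightarrow> op_le S U"
  define E where "E = {(c, d). ap (diag c d) \<in> D}"
  obtain c0 d0 where S_eq: "S = ap (diag c0 d0)" using S(1) by (auto simp: B_def)
  have sa: "selfadj (ap (diag c d))" if "(c, d) \<in> E" for c d using that D by (auto simp: E_def)
  have sa0: "selfadj (ap (diag c0 d0))" using S(2) S_eq by simp
  have le0: "Re c \<le> Re c0" "Re d \<le> Re d0" if "(c, d) \<in> E" for c d
    using that S(3) op_le_diag[OF sa[OF that] sa0] by (auto simp: E_def S_eq)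
  have D_eq: "D = (\<lambda>(c, d). ap (diag c d)) ` E" using DB by (force simp: E_def B_def)
  have "E \<noteq> {}" using \<open>D \<noteq> {}\<close> unfolding D_eq by auto
  define c1 where "c1 = Sup ((\<lambda>(c, d). Re c) ` E)"
  define d1 where "d1 = Sup ((\<lambda>(c, d). Re d) ` E)"
  have bdd: "bdd_above ((\<lambda>(c, d). Re c) ` E)" "bdd_above ((\<lambda>(c, d). Re d) ` E)"
    using le0 by (auto intro!: bdd_aboveI2)
  have le1: "Re c \<le> c1" "Re d \<le> d1" if "(c, d) \<in> E" for c d
    unfolding c1_def d1_def using that by (force intro!: cSup_upper bdd)+
  have sa1: "selfadj (ap (diag c1 d1))" by (simp add: selfadj_ap star_diag)
  have "op_le S (ap (diag c1 d1))"
  proof (rule least[rule_format], intro conjI ballI sa1)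
    fix T assume "T \<in> D"
    then obtain c d where cd: "(c, d) \<in> E" "T = ap (diag c d)" unfolding D_eq by auto
    then show "op_le T (ap (diag c1 d1))" using le1 op_le_diag[OF sa[OF cd(1)] sa1] by simp
  qed
  then have S_le: "Re c0 \<le> c1" "Re d0 \<le> d1" using op_le_diag[OF sa0 sa1] by (simp_all add: S_eq)
  have Re_nu: "Re (\<nu> (ap (diag c d))) = wt * Re c + (1 - wt) * Re d" for c d
    by (simp add: nu_diag)
  have "(SUP T\<in>D. Re (\<nu> T)) = Re (\<nu> S)"
  proof (rule cSup_eq_non_empty)
    show "(\<lambda>T. Re (\<nu> T)) ` D \<noteq> {}" using \<open>D \<noteq> {}\<close> by simp
    fix y assume "y \<in> (\<lambda>T. Re (\<nu> T)) ` D"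
    then obtain c d where cd: "(c, d) \<in> E" "y = Re (\<nu> (ap (diag c d)))" unfolding D_eq by auto
    show "y \<le> Re (\<nu> S)"
      unfolding cd S_eq Re_nu using le0[OF cd(1)] wt by (intro add_mono mult_left_mono) auto
  next
    fix M assume M: "\<And>y. y \<in> (\<lambda>T. Re (\<nu> T)) ` D \<Longrightarrow> y \<le> M"
    show "Re (\<nu> S) \<le> M"
    proof (rule field_le_epsilon)
      fix \<epsilon> :: real assume "\<epsilon> > 0"
      obtain c d where cd: "(c, d) \<in> E" "c1 - \<epsilon> < Re c"
        using less_cSupD[of "(\<lambda>(c, d). Re c) ` E" "c1 - \<epsilon>"] \<open>E \<noteq> {}\<close> \<open>\<epsilon> > 0\<close>
        by (auto simp: c1_def[symmetric])
      obtain c' d' where cd': "(c', d') \<in> E" "d1 - \<epsilon> < Re d'"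
        using less_cSupD[of "(\<lambda>(c, d). Re d) ` E" "d1 - \<epsilon>"] \<open>E \<noteq> {}\<close> \<open>\<epsilon> > 0\<close>
        by (auto simp: d1_def[symmetric])
      have "ap (diag c d) \<in> D" "ap (diag c' d') \<in> D" using cd cd' by (auto simp: E_def)
      \<comment> \<open>The two coordinates are approximated by different elements of
        \<open>D\<close>; \<open>V\<close> lies above both.\<close>
      then obtain V where V: "V \<in> D" "op_le (ap (diag c d)) V" "op_le (ap (diag c' d')) V" using dir by blast
      then obtain v w where vw: "(v, w) \<in> E" "V = ap (diag v w)" unfolding D_eq by auto
      have "Re c \<le> Re v" "Re d' \<le> Re w"
        using V(2,3) op_le_diag[OF sa[OF cd(1)] sa[OF vw(1)]] op_le_diag[OF sa[OF cd'(1)] sa[OF vw(1)]]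
        by (simp_all add: vw)
      then have "Re c0 \<le> Re v + \<epsilon>" "Re d0 \<le> Re w + \<epsilon>" using S_le cd cd' by auto
      then have "Re (\<nu> S) \<le> wt * (Re v + \<epsilon>) + (1 - wt) * (Re w + \<epsilon>)"
        unfolding S_eq Re_nu using wt by (intro add_mono mult_left_mono) auto
      also have "\<dots> = Re (\<nu> V) + \<epsilon>" unfolding vw Re_nu by (simp add: algebra_simps)
      also have "Re (\<nu> V) \<le> M" using M V(1) by blast
      finally show "Re (\<nu> S) \<le> M + \<epsilon>" by simp
    qed
  qed
  then show "Re (\<nu> S) = (SUP T\<in>D. Re (\<nu> T))" by simp
qed

lemma identity_system_B: "identity_system G B \<nu> (\<lambda>_ T. T)"
  using vna_B sigma_finite_B state_B normal_B
  by (simp add: identity_system_def dynamical_system_def star_automorphism_def bij_betw_def)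

end

text \<open>On a space of dimension 0 or 1 every operator is scalar, so a nonscalar one leaves room
  for two orthonormal vectors.\<close>

lemma orthonormal_pair_exists:
  assumes "\<And>c. t \<noteq> scC c (1 :: 'h::chilbert cop)"
  shows "\<exists>e f :: 'h. cinner e e = 1 \<and> cinner f f = 1 \<and> cinner e f = 0"
proof -
  have normalise: "\<exists>k. cinner (cscale k x) (cscale k x) = 1" if "x \<noteq> 0" for x :: 'h
  proof
    have "hnorm x \<noteq> 0" using that by (simp add: hnorm_eq_zero)
    then show "cinner (cscale (of_real (1 / hnorm x)) x) (cscale (of_real (1 / hnorm x)) x) = 1"
      unfolding cinner_scale_left cinner_scale_right unfolding cinner_self by (simp add: power2_eq_square)
  qed
  have "t \<noteq> 0" using assms[of 0] by (simp add: scC_zero)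
  then obtain x where "ap t x \<noteq> 0" using cop_eqI[of t 0] by auto
  then have "x \<noteq> 0" by auto
  then obtain e :: 'h where e: "cinner e e = 1" using normalise by blast
  have "\<exists>y. y \<noteq> cscale (cinner e y) e"
  proof (rule ccontr)
    assume "\<not> ?thesis"
    then have span: "y = cscale (cinner e y) e" for y by blast
    have "t = scC (cinner e (ap t e)) 1"
    proof (rule cop_eqI)
      fix y
      have "ap t y = cscale (cinner e y) (ap t e)" using arg_cong[OF span[of y], of "ap t"] by simp
      also have "ap t e = cscale (cinner e (ap t e)) e" by (rule span)
      also have "cscale (cinner e y) \<dots> = cscale (cinner e (ap t e)) (cscale (cinner e y) e)"
        by (simp add: cscale_cscale mult.commute)
      also have "cscale (cinner e y) e = y" by (rule span[symmetric])
      finally show "ap t y = ap (scC (cinner e (ap t e)) 1) y" by simp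
    qed
    with assms show False by blast
  qed
  then obtain y where y: "y \<noteq> cscale (cinner e y) e" by blast
  define z where "z = y - cscale (cinner e y) e"
  have "z \<noteq> 0" "cinner e z = 0" using y by (simp_all add: z_def cinner_simps e)
  moreover then obtain k where "cinner (cscale k z) (cscale k z) = 1" using normalise by blast
  ultimately have "cinner (cscale k z) (cscale k z) = 1" "cinner e (cscale k z) = 0"
    by (simp_all add: cinner_simps)
  with e show ?thesis by blast
qed

section \<open>Positivity and construction of the joining\<close>

lemma star_sum: "star (sum g I) = (\<Sum>i\<in>I. star (g i))"
  by (induction I rule: infinite_finite_induct) simp_all

text \<open>The double sum is \<phi> at the square of the combination of the \<open>s i\<close> with
  coefficients \<open>c i\<close>. Positivity on the tensor product reduces to one such sum for each
  coordinate of \<open>B\<close>.\<close>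

lemma (in vn_state) gram_sum_cpos:
  fixes n :: nat
  assumes add: "\<And>s t. s \<in> A \<Longrightarrow> t \<in> A \<Longrightarrow> \<phi> (s + t) = \<phi> s + \<phi> t"
    and scale: "\<And>c t. t \<in> A \<Longrightarrow> \<phi> (scC c t) = c * \<phi> t"
    and pos: "\<And>t. t \<in> A \<Longrightarrow> cpos (\<phi> (star t * t))"
    and s: "\<And>i. i < n \<Longrightarrow> s i \<in> A"
  shows "cpos (\<Sum>i<n. \<Sum>j<n. \<phi> (star (s i) * s j) * (cnj (c i) * c j))"
proof -
  have phi_sum: "\<phi> (sum g I) = (\<Sum>i\<in>I. \<phi> (g i))" if "\<And>i. i \<in> I \<Longrightarrow> g i \<in> A" for g and I :: "nat set"
    using that
  proof (induction I rule: infinite_finite_induct)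
    case (insert i I) then show ?case by (simp add: add sum_closed)
  qed (use scale[OF zero_closed, of 0] in \<open>simp_all add: scC_zero\<close>)
  define t where "t = (\<Sum>i<n. scC (c i) (s i))"
  have t: "t \<in> A" unfolding t_def by (intro sum_closed) (simp add: s)
  have "star t * t = (\<Sum>i<n. \<Sum>j<n. scC (cnj (c i) * c j) (star (s i) * s j))"
    unfolding t_def star_sum sum_product by (simp add: scC_simps mult.commute)
  then have "\<phi> (star t * t) = \<phi> (\<Sum>i<n. \<Sum>j<n. scC (cnj (c i) * c j) (star (s i) * s j))" by simp
  also have "\<dots> = (\<Sum>i<n. \<phi> (\<Sum>j<n. scC (cnj (c i) * c j) (star (s i) * s j)))"
    by (rule phi_sum, rule sum_closed) (simp add: s)
  also have "\<dots> = (\<Sum>i<n. \<Sum>j<n. \<phi> (scC (cnj (c i) * c j) (star (s i) * s j)))"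
    by (intro sum.cong refl phi_sum) (simp add: s)
  also have "\<dots> = (\<Sum>i<n. \<Sum>j<n. \<phi> (star (s i) * s j) * (cnj (c i) * c j))"
    by (intro sum.cong refl) (simp add: s scale mult.commute)
  finally have "\<phi> (star t * t) = (\<Sum>i<n. \<Sum>j<n. \<phi> (star (s i) * s j) * (cnj (c i) * c j))" .
  with pos[OF t] show ?thesis by simp
qed

lemma cpos_add: "cpos z \<Longrightarrow> cpos w \<Longrightarrow> cpos (z + w)"
  by (simp add: cpos_def)

lemma ergodic_of_fixed_scalars:
  fixes A :: "('h::chilbert \<Rightarrow> 'h) set"
  assumes sys: "dynamical_system G A \<mu> \<alpha>"
    and scalar: "\<And>t. ap t \<in> A \<Longrightarrow> (\<And>g. g \<in> carrier G \<Longrightarrow> \<alpha> g (ap t) = ap t) \<Longrightarrow> \<exists>c. t = scC c 1"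
  shows "ergodic G A \<alpha>"
proof -
  interpret vn_system "{t. ap t \<in> A}" "\<lambda>t. \<mu> (ap t)" "(\<lambda>g t. Cop (\<alpha> g (ap t))) ` carrier G"
    by (rule dynamical_system_vn_system[OF sys])
  note sys' = sys[unfolded dynamical_system_def von_neumann_algebra_def]
  have scalar_ap: "op_scale c id = ap (scC c 1)" for c by (simp add: ap_ops)
  show ?thesis
    unfolding ergodic_def fixed_point_algebra_def
  proof (intro equalityI subsetI)
    fix T assume T: "T \<in> {a \<in> A. \<forall>g\<in>carrier G. \<alpha> g a = a}"
    then have ap: "ap (Cop T) = T" using sys' ap_Cop by blast
    then obtain c where "Cop T = scC c 1" using T scalar[of "Cop T"] by auto
    then have "T = op_scale c id" using ap by (simp add: scalar_ap)
    then show "T \<in> {op_scale c id |c. True}" by blast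
  next
    fix T :: "'h \<Rightarrow> 'h" assume "T \<in> {op_scale c id |c. True}"
    then obtain c where T: "T = op_scale c id" by blast
    have id: "id \<in> A" using one_closed by (simp add: ap_ops)
    have "op_scale c id \<in> A" unfolding scalar_ap using scC_closed[OF one_closed] by simp
    moreover have "\<alpha> g (op_scale c id) = op_scale c id" if "g \<in> carrier G" for g
    proof -
      have aut: "star_automorphism A (\<alpha> g)" using sys' that by blast
      then have "\<alpha> g (op_scale c id) = op_scale c (\<alpha> g id)" using id unfolding star_automorphism_def by blast
      then show ?thesis by (simp add: automorphism_id[OF aut id])
    qed
    ultimately show "T \<in> {a \<in> A. \<forall>g\<in>carrier G. \<alpha> g a = a}" unfolding T by blast
  qed
qed

text \<open>Since \<open>B\<close> is a copy of two complex coordinates, its tensor product with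
  \<open>A\<close> is a direct sum of two copies of \<open>A\<close>, and a functional there is a
  pair of functionals on \<open>A\<close>. Then \<open>split\<close> yields the marginal on
  \<open>A\<close>, and \<open>weights\<close> the marginal on \<open>B\<close>.\<close>

lemma joining_of_invariant_functionals:
  fixes A :: "('h::chilbert \<Rightarrow> 'h) set"
  assumes sys: "dynamical_system G A \<mu> \<alpha>"
    and tp: "two_point e f wt"
    and add: "\<And>i s t. ap s \<in> A \<Longrightarrow> ap t \<in> A \<Longrightarrow> \<phi> i (s + t) = \<phi> i s + \<phi> i t"
    and scale: "\<And>i c t. ap t \<in> A \<Longrightarrow> \<phi> i (scC c t) = c * \<phi> i t"
    and pos: "\<And>i t. ap t \<in> A \<Longrightarrow> cpos (\<phi> i (star t * t))"
    and inv: "\<And>i g t. g \<in> carrier G \<Longrightarrow> ap t \<in> A \<Longrightarrow> \<phi> i (Cop (\<alpha> g (ap t))) = \<phi> i t"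
    and split: "\<And>t. ap t \<in> A \<Longrightarrow> \<phi> True t + \<phi> False t = \<mu> (ap t)"
    and weights: "\<phi> True 1 = of_real wt" "\<phi> False 1 = of_real (1 - wt)"
  shows "joining G A \<mu> \<alpha> (two_point.B e) (two_point.\<nu> e f wt) (\<lambda>_ T. T)
    (\<lambda>a b. \<phi> True (Cop a) * cinner e (b e) + \<phi> False (Cop a) * cinner f (b f))"
proof -
  interpret two_point e f wt by (rule tp)
  interpret vn_system "{t. ap t \<in> A}" "\<lambda>t. \<mu> (ap t)" "(\<lambda>g t. Cop (\<alpha> g (ap t))) ` carrier G"
    by (rule dynamical_system_vn_system[OF sys])
  note sys' = sys[unfolded dynamical_system_def von_neumann_algebra_def]
  have ap_Cop_A: "ap (Cop a) = a" if "a \<in> A" for a using that sys' ap_Cop by blast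
  have Cop_ap: "Cop (ap t) = t" for t :: "'h cop" by (rule ap_inverse)
  define \<omega> where "\<omega> a b = \<phi> True (Cop a) * cinner e (b e) + \<phi> False (Cop a) * cinner f (b f)" for a b
  have Cop_add: "Cop (op_add a a') = Cop a + Cop a'" if "a \<in> A" "a' \<in> A" for a a'
    using that by (metis ap_Cop_A ap_ops(3) Cop_ap)
  have Cop_scale: "Cop (op_scale c a) = scC c (Cop a)" if "a \<in> A" for a c
    using that by (metis ap_Cop_A ap_ops(4) Cop_ap)
  have Cop_id: "Cop (id :: 'h \<Rightarrow> 'h) = 1" using Cop_ap[of 1] by (simp add: ap_ops)
  have state: "tensor_state A B \<omega>"
    unfolding tensor_state_def
  proof (intro conjI ballI allI impI)
    show "\<omega> (op_add a a') b = \<omega> a b + \<omega> a' b" if "a \<in> A" "a' \<in> A" for a a' b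
      using that by (simp add: \<omega>_def Cop_add add ap_Cop_A algebra_simps)
    show "\<omega> a (op_add b b') = \<omega> a b + \<omega> a b'" for a b b'
      by (simp add: \<omega>_def op_add_def cinner_simps algebra_simps)
    show "\<omega> (op_scale c a) b = c * \<omega> a b" if "a \<in> A" for a b c
      using that by (simp add: \<omega>_def Cop_scale scale ap_Cop_A algebra_simps)
    show "\<omega> a (op_scale c b) = c * \<omega> a b" for a b c
      by (simp add: \<omega>_def op_scale_def cinner_simps algebra_simps)
    show "\<omega> id id = 1" by (simp add: \<omega>_def Cop_id weights ee ff)
    fix n and a b :: "nat \<Rightarrow> 'h \<Rightarrow> 'h"
    assume ab: "\<forall>i<n. a i \<in> A \<and> b i \<in> B"
    define s where "s i = Cop (a i)" for i
    have s: "s i \<in> {t. ap t \<in> A}" if "i < n" for i using ab that by (simp add: s_def ap_Cop_A)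
    have "\<exists>c d. b i = ap (diag c d)" if "i < n" for i using ab that by (auto simp: B_def)
    then obtain c d where cd: "\<And>i. i < n \<Longrightarrow> b i = ap (diag (c i) (d i))" by metis
    have "\<omega> (adj (a i) \<circ> a j) (adj (b i) \<circ> b j)
      = \<phi> True (star (s i) * s j) * (cnj (c i) * c j) + \<phi> False (star (s i) * s j) * (cnj (d i) * d j)"
      if "i < n" "j < n" for i j
    proof -
      have "adj (a i) \<circ> a j = ap (star (s i) * s j)"
        using ab that by (simp add: ap_ops s_def ap_Cop_A)
      moreover have "adj (b i) \<circ> b j = ap (diag (cnj (c i) * c j) (cnj (d i) * d j))"
        unfolding cd[OF that(1)] cd[OF that(2)] by (simp add: diag_simps flip: ap_ops)
      ultimately show ?thesis
        by (simp only: \<omega>_def Cop_ap diag_e diag_f cinner_scale_right ee ff mult_1_right)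
    qed
    then have "(\<Sum>i<n. \<Sum>j<n. \<omega> (adj (a i) \<circ> a j) (adj (b i) \<circ> b j))
      = (\<Sum>i<n. \<Sum>j<n. \<phi> True (star (s i) * s j) * (cnj (c i) * c j))
        + (\<Sum>i<n. \<Sum>j<n. \<phi> False (star (s i) * s j) * (cnj (d i) * d j))"
      by (simp add: sum.distrib)
    moreover have "cpos (\<Sum>i<n. \<Sum>j<n. \<phi> k (star (s i) * s j) * (cnj (c i) * c j))" for k c
      by (rule gram_sum_cpos) (use add scale pos s in auto)
    ultimately show "cpos (\<Sum>i<n. \<Sum>j<n. \<omega> (adj (a i) \<circ> a j) (adj (b i) \<circ> b j))"
      by (simp only: cpos_add)
  qed
  have "joining G A \<mu> \<alpha> B \<nu> (\<lambda>_ T. T) \<omega>"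
    unfolding joining_def
  proof (intro conjI ballI state)
    show "\<omega> a id = \<mu> a" if "a \<in> A" for a
      using split[of "Cop a"] that by (simp add: \<omega>_def ap_Cop_A ee ff)
    show "\<omega> id b = \<nu> b" for b by (simp add: \<omega>_def \<nu>_def Cop_id weights)
    show "\<omega> (\<alpha> g a) b = \<omega> a b" if "g \<in> carrier G" "a \<in> A" for g a b
      using inv[OF that(1), of "Cop a"] that(2) by (simp add: \<omega>_def ap_Cop_A)
  qed
  then show ?thesis by (simp add: \<omega>_def[abs_def])
qed

theorem theorem3p3:
  fixes G :: "('g, 'm) monoid_scheme"
    and A :: "('h::chilbert \<Rightarrow> 'h) set"
    and \<mu> :: "('h \<Rightarrow> 'h) \<Rightarrow> complex"
    and \<alpha> :: "'g \<Rightarrow> ('h \<Rightarrow> 'h) \<Rightarrow> ('h \<Rightarrow> 'h)"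
  assumes "group G"
    and "dynamical_system G A \<mu> \<alpha>"
    and "\<forall>B \<nu> \<beta>. identity_system G B \<nu> \<beta> \<longrightarrow> disjoint_systems G A \<mu> \<alpha> B \<nu> \<beta>"
  shows "ergodic G A \<alpha>"
proof (rule ergodic_of_fixed_scalars[OF assms(2)], rule ccontr)
  fix t
  assume t: "ap t \<in> A" "\<And>g. g \<in> carrier G \<Longrightarrow> \<alpha> g (ap t) = ap t" and "\<not> (\<exists>c. t = scC c 1)"
  then have nonscalar: "t \<noteq> scC c 1" for c by blast
  interpret vn_system "{t. ap t \<in> A}" "\<lambda>t. \<mu> (ap t)" "(\<lambda>g t. Cop (\<alpha> g (ap t))) ` carrier G"
    by (rule dynamical_system_vn_system[OF assms(2)])
  have "\<exists>a x. a \<in> {t. ap t \<in> A} \<and> star a = a \<and> (\<forall>f\<in>(\<lambda>g t. Cop (\<alpha> g (ap t))) ` carrier G. f a = a)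
      \<and> \<mu> (ap a) = 0 \<and> 0 < qf a x"
    by (rule centred_fixed_point[of t]) (use t nonscalar in \<open>auto simp: ap_inverse\<close>)
  then obtain a x where a: "a \<in> {t. ap t \<in> A}" "star a = a"
      "\<forall>f\<in>(\<lambda>g t. Cop (\<alpha> g (ap t))) ` carrier G. f a = a" "\<mu> (ap a) = 0" "0 < qf a x"
    by blast
  obtain \<psi> where \<psi>: "\<forall>s\<in>{t. ap t \<in> A}. \<forall>t\<in>{t. ap t \<in> A}. \<psi> (s + t) = \<psi> s + \<psi> t"
      "\<forall>t\<in>{t. ap t \<in> A}. \<forall>c. \<psi> (scC c t) = c * \<psi> t"
      "\<forall>t\<in>{t. ap t \<in> A}. cpos (\<psi> (star t * t)) \<and> cpos (\<mu> (ap (star t * t)) - \<psi> (star t * t))"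
      "\<forall>f\<in>(\<lambda>g t. Cop (\<alpha> g (ap t))) ` carrier G. \<forall>t\<in>{t. ap t \<in> A}. \<psi> (f t) = \<psi> t"
    and \<psi>_a: "0 < Re (\<psi> a)"
    using invariant_functional_exists[OF a(1-3,5)] by blast
  have \<psi>_add: "\<psi> (s + t) = \<psi> s + \<psi> t" if "ap s \<in> A" "ap t \<in> A" for s t using \<psi>(1) that by blast
  have \<psi>_scale: "\<psi> (scC c t) = c * \<psi> t" if "ap t \<in> A" for c t using \<psi>(2) that by blast
  have \<psi>_pos: "cpos (\<psi> (star t * t))" "cpos (\<mu> (ap (star t * t)) - \<psi> (star t * t))"
    if "ap t \<in> A" for t using \<psi>(3) that by blast+
  have \<psi>_inv: "\<psi> (Cop (\<alpha> g (ap t))) = \<psi> t" if "g \<in> carrier G" "ap t \<in> A" for g t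
    using \<psi>(4) that by simp
  have one: "ap 1 \<in> A" using one_closed by simp
  \<comment> \<open>Adding \<open>\<mu>\<close> keeps the weight of the first functional strictly between 0 and 1.\<close>
  define \<phi> where "\<phi> i t = (if i then (\<mu> (ap t) + \<psi> t) / 3 else (2 * \<mu> (ap t) - \<psi> t) / 3)" for i t
  define wt where "wt = Re (\<phi> True 1)"
  have \<psi>_one: "Im (\<psi> 1) = 0" "0 \<le> Re (\<psi> 1)" "Re (\<psi> 1) \<le> 1"
    using \<psi>_pos[OF one] mu_one by (auto simp: cpos_def)
  \<comment> \<open>As \<open>\<psi> 1\<close> lies between 0 and 1, \<open>wt\<close> lies between
    1/3 and 2/3.\<close>
  have wt: "0 < wt" "wt < 1" "\<phi> True 1 = of_real wt" "\<phi> False 1 = of_real (1 - wt)"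
    using \<psi>_one mu_one by (auto simp: wt_def \<phi>_def complex_eq_iff field_simps)
  obtain e f :: 'h where ef: "cinner e e = 1" "cinner f f = 1" "cinner e f = 0"
    using orthonormal_pair_exists[OF nonscalar] by blast
  interpret tp: two_point e f wt by unfold_locales (use ef wt in auto)
  define \<omega> where "\<omega> a b = \<phi> True (Cop a) * cinner e (b e) + \<phi> False (Cop a) * cinner f (b f)" for a b
  have "joining G A \<mu> \<alpha> tp.B tp.\<nu> (\<lambda>_ T. T) \<omega>"
    unfolding \<omega>_def[abs_def]
  proof (rule joining_of_invariant_functionals[OF assms(2) tp.two_point_axioms])
    show "\<phi> i (s + t) = \<phi> i s + \<phi> i t" if "ap s \<in> A" "ap t \<in> A" for i s t
      using that by (simp add: \<phi>_def \<psi>_add mu_add field_simps)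
    show "\<phi> i (scC c t) = c * \<phi> i t" if "ap t \<in> A" for i c t
      using that by (simp add: \<phi>_def \<psi>_scale mu_scC field_simps)
    show "cpos (\<phi> i (star t * t))" if "ap t \<in> A" for i t
      using \<psi>_pos[OF that] mu_square[of t] that by (auto simp: \<phi>_def cpos_def)
    show "\<phi> i (Cop (\<alpha> g (ap t))) = \<phi> i t" if "g \<in> carrier G" "ap t \<in> A" for i g t
      using \<psi>_inv[OF that] mu_map[of "\<lambda>t. Cop (\<alpha> g (ap t))" t] that by (auto simp: \<phi>_def)
    show "\<phi> True t + \<phi> False t = \<mu> (ap t)" for t by (simp add: \<phi>_def field_simps)
  qed (rule wt)+
  \<comment> \<open>The test element pairs \<open>a\<close> with \<open>p\<close>: the product state
    vanishes there since \<open>\<mu> a = 0\<close>, while \<omega> gives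
    \<open>\<phi> True a\<close>, one third of \<open>\<psi> a\<close>.\<close>
  then have "\<omega> (ap a) (ap tp.p) = \<mu> (ap a) * tp.\<nu> (ap tp.p)"
  proof -
    have "disjoint_systems G A \<mu> \<alpha> tp.B tp.\<nu> (\<lambda>_ T. T)"
      using assms(3) tp.identity_system_B by blast
    moreover have "tp.p = tp.diag 1 0" by (simp add: tp.diag_def scC_zero)
    then have "ap tp.p \<in> tp.B" by (auto simp: tp.B_def)
    ultimately show ?thesis
      using a(1) \<open>joining G A \<mu> \<alpha> tp.B tp.\<nu> (\<lambda>_ T. T) \<omega>\<close> by (auto simp: disjoint_systems_def)
  qed
  then have "\<phi> True a = 0"
    using a(4) ef by (simp add: \<omega>_def tp.p_def ap_inverse cinner_simps)
  then show False using \<psi>_a a(4) by (auto simp: \<phi>_def)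
qed

end
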